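(* Let $\mathbf{C}$ be an a.s.-compatibly representable Markov category, with associated monad $(P,\mu,\delta)$ on $\mathbf{C}_{\mathrm{det}}$. If $\mathbf{C}$ has conditionals, then $\mu$ is weakly cartesian; that is, for every deterministic morphism $f:X\to Y$ the naturality square of $\mu$ at $f$ (with sides $PPf:PPX\to PPY$, $\mu_X:PPX\to PX$, $\mu_Y:PPY\to PY$, $Pf:PX\to PY$) is a weak pullback in $\mathbf{C}_{\mathrm{det}}$.
   Context: A Markov category is a symmetric monoidal category $(\mathbf{C},\otimes,I)$ (coherence isomorphisms suppressed) in which every object $X$ carries a distinguished commutative comonoid structure $\mathrm{copy}_X:X\to X\otimes X$, $\mathrm{del}_X:X\to I$, compatible with the tensor product, and such that $\mathrm{del}_Y\circ f=\mathrm{del}_X$ for every $f:X\to Y$ (equivalently, $I$ is terminal). A morphism $f:A\to X$ is deterministic if $\mathrm{copy}_X\circ f=(f\otimes f)\circ\mathrm{copy}_A$; $\mathbf{C}_{\mathrm{det}}$ is the subcategory of all objects and deterministic morphisms. Conditionals: a conditional of $f:A\to X\otimes Y$ with respect to $X$ is a morphism $f|_X:X\otimes A\to Y$ with $f=(\mathrm{id}_X\otimes f|_X)\circ(\mathrm{copy}_X\otimes \mathrm{id}_A)\circ(f_X\otimes \mathrm{id}_A)\circ\mathrm{copy}_A$, where $f_X=(\mathrm{id}_X\otimes\mathrm{del}_Y)\circ f$. $\mathbf{C}$ has conditionals if every morphism admits a conditional with respect to any of its outputs. Almost sure equality: for $p:A\to X$ and $f,g:X\to Y$, write $f=_{p\text{-a.s.}}g$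 if $(\mathrm{id}_X\otimes f)\circ\mathrm{copy}_X\circ p=(\mathrm{id}_X\otimes g)\circ\mathrm{copy}_X\circ p$. Representability: a distribution object for $X$ is an object $PX$ with a morphism $\mathrm{samp}_X:PX\to X$ such that $\mathrm{samp}_X\circ-:\mathbf{C}_{\mathrm{det}}(A,PX)\to\mathbf{C}(A,X)$ is a bijection for every $A$; its inverse is denoted $f\mapsto f^\#$, and $\delta_X:=(1_X)^\#:X\to PX$. $\mathbf{C}$ is representable if every object has a distribution object. Then $P$ becomes a functor $\mathbf{C}\to\mathbf{C}_{\mathrm{det}}$, $Pf=(f\circ\mathrm{samp}_X)^\#$ for $f:X\to Y$, right adjoint to the inclusion $\mathbf{C}_{\mathrm{det}}\hookrightarrow\mathbf{C}$ with unit $\delta$ and counit $\mathrm{samp}$; the associated monad on $\mathbf{C}_{\mathrm{det}}$ is $(P,\mu,\delta)$ with $\mu_X=P(\mathrm{samp}_X)$. $\mathbf{C}$ is a.s.-compatibly representable if it is representable and, for every $p:\Theta\to A$ and all $f,g:A\to X$, $f^\#=_{p\text{-a.s.}}g^\#$ if and only if $f=_{p\text{-a.s.}}g$. Weak pullback: a commutative square $m\circ f=n\circ g$ (with $f:A\to B$, $g:A\to C$, $m:B\to D$, $n:C\to D$) is a weak pullback if for every object $S$ and all $q:S\to B$, $p:S\to C$ with $m\circ q=n\circ p$ there is a (not necessarily unique) $r:S\to A$ with $f\circ r=q$ and $g\circ r=p$. *)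

theory Defs
  imports Main
begin

text \<open>
  A category is given by a set of objects, a set of arrows with domain and codomain, identities and
  composition; \<open>g \<cdot> f\<close> means "g after f". All operations are total functions, and their
  values are only constrained on objects and on composable arrows.
\<close>

record ('o, 'm) category =
  Obj :: "'o set"
  Arr :: "'m set"
  Dom :: "'m \<Rightarrow> 'o"
  Cod :: "'m \<Rightarrow> 'o"
  Ident :: "'o \<Rightarrow> 'm"  (\<open>\<one>\<index>\<close>)
  Comp :: "'m \<Rightarrow> 'm \<Rightarrow> 'm"  (infixr \<open>\<cdot>\<index>\<close> 55)

definition hom :: "('o, 'm, 'z) category_scheme \<Rightarrow> 'o \<Rightarrow> 'o \<Rightarrow> 'm set"
  where "hom C X Y = {f \<in> Arr C. Dom C f = X \<and> Cod C f = Y}"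

locale category =
  fixes C :: "('o, 'm, 'z) category_scheme" (structure)
  assumes Dom_Obj: "f \<in> Arr C \<Longrightarrow> Dom C f \<in> Obj C"
    and Cod_Obj: "f \<in> Arr C \<Longrightarrow> Cod C f \<in> Obj C"
    and Ident_hom: "X \<in> Obj C \<Longrightarrow> \<one> X \<in> hom C X X"
    and Comp_hom: "\<lbrakk> f \<in> hom C X Y; g \<in> hom C Y Z \<rbrakk> \<Longrightarrow> g \<cdot> f \<in> hom C X Z"
    and Comp_Ident: "f \<in> hom C X Y \<Longrightarrow> f \<cdot> \<one> X = f"
    and Ident_Comp: "f \<in> hom C X Y \<Longrightarrow> \<one> Y \<cdot> f = f"
    and Comp_assoc: "\<lbrakk> f \<in> hom C W X; g \<in> hom C X Y; h \<in> hom C Y Z \<rbrakk>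
      \<Longrightarrow> (h \<cdot> g) \<cdot> f = h \<cdot> (g \<cdot> f)"

definition inverse_arrows :: "('o, 'm, 'z) category_scheme \<Rightarrow> 'm \<Rightarrow> 'm \<Rightarrow> bool"
  where "inverse_arrows C f g \<longleftrightarrow> f \<in> Arr C \<and> g \<in> hom C (Cod C f) (Dom C f) \<and>
    g \<cdot>\<^bsub>C\<^esub> f = \<one>\<^bsub>C\<^esub> (Dom C f) \<and> f \<cdot>\<^bsub>C\<^esub> g = \<one>\<^bsub>C\<^esub> (Cod C f)"

definition is_iso :: "('o, 'm, 'z) category_scheme \<Rightarrow> 'm \<Rightarrow> bool"
  where "is_iso C f \<longleftrightarrow> (\<exists>g. inverse_arrows C f g)"

definition inv_arrow :: "('o, 'm, 'z) category_scheme \<Rightarrow> 'm \<Rightarrow> 'm"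
  where "inv_arrow C f = (THE g. inverse_arrows C f g)"

text \<open>
  The square with \<open>f : A \<rightarrow> B\<close>, \<open>g : A \<rightarrow> C\<close>, \<open>m : B \<rightarrow> E\<close>, \<open>n : C \<rightarrow> E\<close>.
\<close>

definition weak_pullback ::
  "('o, 'm, 'z) category_scheme \<Rightarrow> 'o \<Rightarrow> 'o \<Rightarrow> 'o \<Rightarrow> 'o \<Rightarrow> 'm \<Rightarrow> 'm \<Rightarrow> 'm \<Rightarrow> 'm \<Rightarrow> bool"
  where "weak_pullback D A B C E f g m n \<longleftrightarrow>
    f \<in> hom D A B \<and> g \<in> hom D A C \<and> m \<in> hom D B E \<and> n \<in> hom D C E \<and>
    m \<cdot>\<^bsub>D\<^esub> f = n \<cdot>\<^bsub>D\<^esub> g \<and>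
    (\<forall>S\<in>Obj D. \<forall>q\<in>hom D S B. \<forall>p\<in>hom D S C. m \<cdot>\<^bsub>D\<^esub> q = n \<cdot>\<^bsub>D\<^esub> p \<longrightarrow>
      (\<exists>r\<in>hom D S A. f \<cdot>\<^bsub>D\<^esub> r = q \<and> g \<cdot>\<^bsub>D\<^esub> r = p))"

text \<open>
  Weak cartesianness of a family \<open>\<alpha>\<close> from the functor with object map \<open>F\<close> and arrow map
  \<open>F'\<close> to the functor with object map \<open>G\<close> and arrow map \<open>G'\<close>, all on the
  category \<open>D\<close>. Naturality is part of the condition, as a weak pullback square commutes.
\<close>

definition weakly_cartesian ::
  "('o, 'm, 'z) category_scheme \<Rightarrow> ('o \<Rightarrow> 'o) \<Rightarrow> ('m \<Rightarrow> 'm) \<Rightarrow> ('o \<Rightarrow> 'o) \<Rightarrow> ('m \<Rightarrow> 'm) \<Rightarrow>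
    ('o \<Rightarrow> 'm) \<Rightarrow> bool"
  where "weakly_cartesian D F F' G G' \<alpha> \<longleftrightarrow>
    (\<forall>X\<in>Obj D. \<forall>Y\<in>Obj D. \<forall>f\<in>hom D X Y.
      weak_pullback D (F X) (F Y) (G X) (G Y) (F' f) (\<alpha> X) (\<alpha> Y) (G' f))"

text \<open>
  Monoidal categories are not assumed strict: \<open>Assoc X Y Z : (X \<otimes> Y) \<otimes> Z \<rightarrow> X \<otimes> (Y \<otimes> Z)\<close>,
  \<open>Lunit X : I \<otimes> X \<rightarrow> X\<close> and \<open>Runit X : X \<otimes> I \<rightarrow> X\<close> are explicit. The tensor product of
  objects is written \<open>\<otimes>\<^sub>o\<close>, that of arrows \<open>\<otimes>\<close>.
\<close>

record ('o, 'm) monoidal_category = "('o, 'm) category" +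
  TensorObj :: "'o \<Rightarrow> 'o \<Rightarrow> 'o"  (infixr \<open>\<otimes>\<^sub>o\<index>\<close> 70)
  Tensor :: "'m \<Rightarrow> 'm \<Rightarrow> 'm"  (infixr \<open>\<otimes>\<index>\<close> 70)
  Unit :: 'o  (\<open>\<I>\<index>\<close>)
  Assoc :: "'o \<Rightarrow> 'o \<Rightarrow> 'o \<Rightarrow> 'm"
  Lunit :: "'o \<Rightarrow> 'm"
  Runit :: "'o \<Rightarrow> 'm"

locale monoidal_category = category C
  for C :: "('o, 'm, 'z) monoidal_category_scheme" (structure) +
  assumes Unit_Obj: "\<I> \<in> Obj C"
    and TensorObj_Obj: "\<lbrakk> X \<in> Obj C; Y \<in> Obj C \<rbrakk> \<Longrightarrow> X \<otimes>\<^sub>o Y \<in> Obj C"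
    and Tensor_hom: "\<lbrakk> f \<in> hom C X X'; g \<in> hom C Y Y' \<rbrakk>
      \<Longrightarrow> f \<otimes> g \<in> hom C (X \<otimes>\<^sub>o Y) (X' \<otimes>\<^sub>o Y')"
    and Tensor_Ident: "\<lbrakk> X \<in> Obj C; Y \<in> Obj C \<rbrakk> \<Longrightarrow> \<one> X \<otimes> \<one> Y = \<one> (X \<otimes>\<^sub>o Y)"
    and Tensor_Comp:
      "\<lbrakk> f \<in> hom C X X'; f' \<in> hom C X' X''; g \<in> hom C Y Y'; g' \<in> hom C Y' Y'' \<rbrakk>
        \<Longrightarrow> (f' \<cdot> f) \<otimes> (g' \<cdot> g) = (f' \<otimes> g') \<cdot> (f \<otimes> g)"
    and Assoc_hom: "\<lbrakk> X \<in> Obj C; Y \<in> Obj C; Z \<in> Obj C \<rbrakk>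
      \<Longrightarrow> Assoc C X Y Z \<in> hom C ((X \<otimes>\<^sub>o Y) \<otimes>\<^sub>o Z) (X \<otimes>\<^sub>o (Y \<otimes>\<^sub>o Z))"
    and Assoc_iso: "\<lbrakk> X \<in> Obj C; Y \<in> Obj C; Z \<in> Obj C \<rbrakk> \<Longrightarrow> is_iso C (Assoc C X Y Z)"
    and Assoc_natural: "\<lbrakk> f \<in> hom C X X'; g \<in> hom C Y Y'; h \<in> hom C Z Z' \<rbrakk>
      \<Longrightarrow> Assoc C X' Y' Z' \<cdot> ((f \<otimes> g) \<otimes> h) = (f \<otimes> (g \<otimes> h)) \<cdot> Assoc C X Y Z"
    and Lunit_hom: "X \<in> Obj C \<Longrightarrow> Lunit C X \<in> hom C (\<I> \<otimes>\<^sub>o X) X"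
    and Lunit_iso: "X \<in> Obj C \<Longrightarrow> is_iso C (Lunit C X)"
    and Lunit_natural: "f \<in> hom C X Y \<Longrightarrow> Lunit C Y \<cdot> (\<one> \<I> \<otimes> f) = f \<cdot> Lunit C X"
    and Runit_hom: "X \<in> Obj C \<Longrightarrow> Runit C X \<in> hom C (X \<otimes>\<^sub>o \<I>) X"
    and Runit_iso: "X \<in> Obj C \<Longrightarrow> is_iso C (Runit C X)"
    and Runit_natural: "f \<in> hom C X Y \<Longrightarrow> Runit C Y \<cdot> (f \<otimes> \<one> \<I>) = f \<cdot> Runit C X"
    and pentagon: "\<lbrakk> W \<in> Obj C; X \<in> Obj C; Y \<in> Obj C; Z \<in> Obj C \<rbrakk>
      \<Longrightarrow> Assoc C W X (Y \<otimes>\<^sub>o Z) \<cdot> Assoc C (W \<otimes>\<^sub>o X) Y Z =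
        (\<one> W \<otimes> Assoc C X Y Z) \<cdot> Assoc C W (X \<otimes>\<^sub>o Y) Z \<cdot> (Assoc C W X Y \<otimes> \<one> Z)"
    and triangle: "\<lbrakk> X \<in> Obj C; Y \<in> Obj C \<rbrakk>
      \<Longrightarrow> (\<one> X \<otimes> Lunit C Y) \<cdot> Assoc C X \<I> Y = Runit C X \<otimes> \<one> Y"

record ('o, 'm) symmetric_monoidal_category = "('o, 'm) monoidal_category" +
  Swap :: "'o \<Rightarrow> 'o \<Rightarrow> 'm"

locale symmetric_monoidal_category = monoidal_category C
  for C :: "('o, 'm, 'z) symmetric_monoidal_category_scheme" (structure) +
  assumes Swap_hom: "\<lbrakk> X \<in> Obj C; Y \<in> Obj C \<rbrakk> \<Longrightarrow> Swap C X Y \<in> hom C (X \<otimes>\<^sub>o Y) (Y \<otimes>\<^sub>o X)"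
    and Swap_Swap: "\<lbrakk> X \<in> Obj C; Y \<in> Obj C \<rbrakk> \<Longrightarrow> Swap C Y X \<cdot> Swap C X Y = \<one> (X \<otimes>\<^sub>o Y)"
    and Swap_natural: "\<lbrakk> f \<in> hom C X X'; g \<in> hom C Y Y' \<rbrakk>
      \<Longrightarrow> Swap C X' Y' \<cdot> (f \<otimes> g) = (g \<otimes> f) \<cdot> Swap C X Y"
    and hexagon: "\<lbrakk> X \<in> Obj C; Y \<in> Obj C; Z \<in> Obj C \<rbrakk>
      \<Longrightarrow> Assoc C Y Z X \<cdot> Swap C X (Y \<otimes>\<^sub>o Z) \<cdot> Assoc C X Y Z =
        (\<one> Y \<otimes> Swap C X Z) \<cdot> Assoc C Y X Z \<cdot> (Swap C X Y \<otimes> \<one> Z)"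

text \<open>
  \<open>id \<otimes> swap \<otimes> id : (X \<otimes> X) \<otimes> (Y \<otimes> Y) \<rightarrow> (X \<otimes> Y) \<otimes> (X \<otimes> Y)\<close>, with the associators inserted.
\<close>

definition mid_swap :: "('o, 'm, 'z) symmetric_monoidal_category_scheme \<Rightarrow> 'o \<Rightarrow> 'o \<Rightarrow> 'm"
  where "mid_swap C X Y =
    inv_arrow C (Assoc C X Y (X \<otimes>\<^sub>o Y)) \<cdot>
    (\<one> X \<otimes> (Assoc C Y X Y \<cdot> (Swap C X Y \<otimes> \<one> Y) \<cdot> inv_arrow C (Assoc C X Y Y))) \<cdot>
    Assoc C X X (Y \<otimes>\<^sub>o Y)"
  for C (structure)

record ('o, 'm) markov_category = "('o, 'm) symmetric_monoidal_category" +
  Copy :: "'o \<Rightarrow> 'm"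
  Del :: "'o \<Rightarrow> 'm"

locale markov_category = symmetric_monoidal_category C
  for C :: "('o, 'm, 'z) markov_category_scheme" (structure) +
  assumes Copy_hom: "X \<in> Obj C \<Longrightarrow> Copy C X \<in> hom C X (X \<otimes>\<^sub>o X)"
    and Del_hom: "X \<in> Obj C \<Longrightarrow> Del C X \<in> hom C X \<I>"
    and Copy_assoc: "X \<in> Obj C
      \<Longrightarrow> Assoc C X X X \<cdot> (Copy C X \<otimes> \<one> X) \<cdot> Copy C X = (\<one> X \<otimes> Copy C X) \<cdot> Copy C X"
    and Copy_Lunit: "X \<in> Obj C \<Longrightarrow> Lunit C X \<cdot> (Del C X \<otimes> \<one> X) \<cdot> Copy C X = \<one> X"
    and Copy_Runit: "X \<in> Obj C \<Longrightarrow> Runit C X \<cdot> (\<one> X \<otimes> Del C X) \<cdot> Copy C X = \<one> X"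
    and Copy_comm: "X \<in> Obj C \<Longrightarrow> Swap C X X \<cdot> Copy C X = Copy C X"
    and Copy_Tensor: "\<lbrakk> X \<in> Obj C; Y \<in> Obj C \<rbrakk>
      \<Longrightarrow> Copy C (X \<otimes>\<^sub>o Y) = mid_swap C X Y \<cdot> (Copy C X \<otimes> Copy C Y)"
    and Del_Tensor: "\<lbrakk> X \<in> Obj C; Y \<in> Obj C \<rbrakk>
      \<Longrightarrow> Del C (X \<otimes>\<^sub>o Y) = Lunit C \<I> \<cdot> (Del C X \<otimes> Del C Y)"
    and Copy_Unit: "Copy C \<I> = inv_arrow C (Lunit C \<I>)"
    and Del_Unit: "Del C \<I> = \<one> \<I>"
    and Del_natural: "f \<in> hom C X Y \<Longrightarrow> Del C Y \<cdot> f = Del C X"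

definition deterministic :: "('o, 'm, 'z) markov_category_scheme \<Rightarrow> 'm \<Rightarrow> bool"
  where "deterministic C f \<longleftrightarrow>
    f \<in> Arr C \<and> Copy C (Cod C f) \<cdot> f = (f \<otimes> f) \<cdot> Copy C (Dom C f)"
  for C (structure)

definition det_category :: "('o, 'm, 'z) markov_category_scheme \<Rightarrow> ('o, 'm) category"
  where "det_category C = \<lparr> Obj = Obj C, Arr = {f \<in> Arr C. deterministic C f},
    Dom = Dom C, Cod = Cod C, Ident = Ident C, Comp = Comp C \<rparr>"

definition marginal :: "('o, 'm, 'z) markov_category_scheme \<Rightarrow> 'o \<Rightarrow> 'o \<Rightarrow> 'm \<Rightarrow> 'm"
  where "marginal C X Y f = Runit C X \<cdot> (\<one> X \<otimes> Del C Y) \<cdot> f"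
  for C (structure)

text \<open>\<open>c : X \<otimes> A \<rightarrow> Y\<close> is a conditional of \<open>f : A \<rightarrow> X \<otimes> Y\<close> with respect to \<open>X\<close>.\<close>

definition conditional ::
  "('o, 'm, 'z) markov_category_scheme \<Rightarrow> 'o \<Rightarrow> 'o \<Rightarrow> 'o \<Rightarrow> 'm \<Rightarrow> 'm \<Rightarrow> bool"
  where "conditional C A X Y f c \<longleftrightarrow>
    f \<in> hom C A (X \<otimes>\<^sub>o Y) \<and> c \<in> hom C (X \<otimes>\<^sub>o A) Y \<and>
    f = (\<one> X \<otimes> c) \<cdot> Assoc C X X A \<cdot> (Copy C X \<otimes> \<one> A) \<cdot> (marginal C X Y f \<otimes> \<one> A) \<cdot> Copy C A"
  for C (structure)

text \<open>
  Conditionals with respect to the first factor suffice: for a different output, apply this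
  to the composite of the arrow with the symmetry that moves that output to the front.
\<close>

definition has_conditionals :: "('o, 'm, 'z) markov_category_scheme \<Rightarrow> bool"
  where "has_conditionals C \<longleftrightarrow>
    (\<forall>A\<in>Obj C. \<forall>X\<in>Obj C. \<forall>Y\<in>Obj C. \<forall>f\<in>hom C A (X \<otimes>\<^sub>o Y). \<exists>c. conditional C A X Y f c)"
  for C (structure)

definition as_equal :: "('o, 'm, 'z) markov_category_scheme \<Rightarrow> 'm \<Rightarrow> 'm \<Rightarrow> 'm \<Rightarrow> bool"
  where "as_equal C p f g \<longleftrightarrow>
    (\<one> (Cod C p) \<otimes> f) \<cdot> Copy C (Cod C p) \<cdot> p = (\<one> (Cod C p) \<otimes> g) \<cdot> Copy C (Cod C p) \<cdot> p"
  for C (structure)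

definition distribution_object ::
  "('o, 'm, 'z) markov_category_scheme \<Rightarrow> 'o \<Rightarrow> 'o \<Rightarrow> 'm \<Rightarrow> bool"
  where "distribution_object C X PX s \<longleftrightarrow>
    PX \<in> Obj C \<and> s \<in> hom C PX X \<and>
    (\<forall>A\<in>Obj C. bij_betw (\<lambda>h. s \<cdot> h) (hom (det_category C) A PX) (hom C A X))"
  for C (structure)

text \<open>
  Distribution objects are unique up to unique deterministic isomorphism. A representable category
  is handled with a choice of them, \<open>samp X : P X \<rightarrow> X\<close> for each object \<open>X\<close>; the functor
  \<open>P\<close>, the monad and a.s.-compatibility are all relative to this choice.
\<close>

definition representable ::
  "('o, 'm, 'z) markov_category_scheme \<Rightarrow> ('o \<Rightarrow> 'o) \<Rightarrow> ('o \<Rightarrow> 'm) \<Rightarrow> bool"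
  where "representable C P samp \<longleftrightarrow> (\<forall>X\<in>Obj C. distribution_object C X (P X) (samp X))"

definition sharp ::
  "('o, 'm, 'z) markov_category_scheme \<Rightarrow> ('o \<Rightarrow> 'o) \<Rightarrow> ('o \<Rightarrow> 'm) \<Rightarrow> 'm \<Rightarrow> 'm"
  where "sharp C P samp f =
    the_inv_into (hom (det_category C) (Dom C f) (P (Cod C f))) (\<lambda>h. samp (Cod C f) \<cdot> h) f"
  for C (structure)

definition P_map ::
  "('o, 'm, 'z) markov_category_scheme \<Rightarrow> ('o \<Rightarrow> 'o) \<Rightarrow> ('o \<Rightarrow> 'm) \<Rightarrow> 'm \<Rightarrow> 'm"
  where "P_map C P samp f = sharp C P samp (f \<cdot> samp (Dom C f))"
  for C (structure)

definition P_mult ::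
  "('o, 'm, 'z) markov_category_scheme \<Rightarrow> ('o \<Rightarrow> 'o) \<Rightarrow> ('o \<Rightarrow> 'm) \<Rightarrow> 'o \<Rightarrow> 'm"
  where "P_mult C P samp X = P_map C P samp (samp X)"

definition as_compatibly_representable ::
  "('o, 'm, 'z) markov_category_scheme \<Rightarrow> ('o \<Rightarrow> 'o) \<Rightarrow> ('o \<Rightarrow> 'm) \<Rightarrow> bool"
  where "as_compatibly_representable C P samp \<longleftrightarrow>
    representable C P samp \<and>
    (\<forall>T\<in>Obj C. \<forall>A\<in>Obj C. \<forall>X\<in>Obj C. \<forall>p\<in>hom C T A. \<forall>f\<in>hom C A X. \<forall>g\<in>hom C A X.
      as_equal C p (sharp C P samp f) (sharp C P samp g) \<longleftrightarrow> as_equal C p f g)"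

end

theory Submission
  imports Defs
begin

text \<open>
  Since \<open>samp \<cdot> _\<close> identifies deterministic arrows into \<open>P X\<close> with arbitrary arrows into \<open>X\<close>, it
  translates the claim about the square of \<open>\<mu>\<close> in the deterministic subcategory into one about the
  square of \<open>samp\<close> in \<open>C\<close> itself: given a deterministic \<open>f : X \<rightarrow> Y\<close> and arrows \<open>q : S \<rightarrow> P Y\<close>,
  \<open>p : S \<rightarrow> X\<close> with \<open>samp Y \<cdot> q = f \<cdot> p\<close>, find \<open>r : S \<rightarrow> P X\<close> with \<open>P f \<cdot> r = q\<close> and \<open>samp X \<cdot> r = p\<close>
  (\<open>samp_weak_pullback\<close>; the reduction is \<open>P_mult_weak_pullback\<close>).

  In probabilistic terms, and for a fixed input from \<open>S\<close>, \<open>q\<close> produces a random measure \<open>\<pi>\<close> on \<open>Y\<close>,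
  and a sample \<open>y\<close> of \<open>\<pi>\<close> has the same law as \<open>f x\<close>, where \<open>x\<close> is drawn from \<open>p\<close>. Couple the
  two experiments over \<open>Y\<close>: draw \<open>x\<close> from \<open>p\<close>, put
  \<open>y = f x\<close>, and draw \<open>\<pi>\<close> from the conditional law of \<open>\<pi>\<close> given \<open>y\<close>. As \<open>f\<close> is deterministic, the pair
  \<open>(y, \<pi>)\<close> has the original joint law, hence \<open>\<pi>\<close> has law \<open>q\<close>. Now let \<open>k\<close> be the conditional law of
  \<open>x\<close> given \<open>\<pi>\<close>, and let \<open>r\<close> draw \<open>\<pi>\<close> from \<open>q\<close> and return the measure \<open>k(\<pi>)\<close> on \<open>X\<close>. Sampling
  from it recovers the law \<open>p\<close> of \<open>x\<close>. Its image under \<open>f\<close> is the conditional law of \<open>y\<close> given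
  \<open>\<pi>\<close>, which is \<open>\<pi>\<close> itself almost surely, because \<open>y\<close> was sampled from \<open>\<pi>\<close>.

  The last step is where a.s.-compatibility enters. Both \<open>f \<cdot> k\<close> and \<open>samp Y\<close> after the projection are
  conditionals of the same arrow, and therefore almost surely equal on \<open>P Y \<otimes> S\<close>
  (\<open>as_equal_graph\<close>); a.s.-compatibility turns this into an almost sure equality of \<open>(f \<cdot> k)\<^sup>#\<close>
  with the projection to \<open>P Y\<close>, the latter being deterministic (\<open>deterministic_proj1\<close>). Every
  conditional depends on the parameter object \<open>S\<close> as well, so these two lemmas have to unfold the copy
  map of a tensor product. Most of the coherence lemmas serve that purpose.
\<close>

section \<open>Typing and cancellation\<close>

text \<open>
  Typing by equations for \<open>Dom\<close> and \<open>Cod\<close>, in place of membership in a \<open>hom\<close>, lets the simplifier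
  discharge the typing conditions of associativity, whose middle objects occur only in the
  premises.
\<close>

context category
begin

lemma hom_iff: "f \<in> hom C X Y \<longleftrightarrow> f \<in> Arr C \<and> Dom C f = X \<and> Cod C f = Y"
  by (simp add: hom_def)

lemma arr_Obj [simp]: "f \<in> Arr C \<Longrightarrow> Dom C f \<in> Obj C" "f \<in> Arr C \<Longrightarrow> Cod C f \<in> Obj C"
  by (fact Dom_Obj Cod_Obj)+

lemma Ident_arr [simp]:
  assumes "X \<in> Obj C"
  shows "\<one> X \<in> Arr C" "Dom C (\<one> X) = X" "Cod C (\<one> X) = X"
  using Ident_hom[OF assms] by (simp_all add: hom_iff)

lemma Comp_arr [simp]:
  assumes "f \<in> Arr C" "g \<in> Arr C" "Dom C g = Cod C f"
  shows "g \<cdot> f \<in> Arr C" "Dom C (g \<cdot> f) = Dom C f" "Cod C (g \<cdot> f) = Cod C g"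
  using Comp_hom[of f "Dom C f" "Cod C f" g "Cod C g"] assms by (simp_all add: hom_iff)

lemma assoc_arr [simp]:
  assumes "f \<in> Arr C" "g \<in> Arr C" "h \<in> Arr C" "Dom C g = Cod C f" "Dom C h = Cod C g"
  shows "(h \<cdot> g) \<cdot> f = h \<cdot> g \<cdot> f"
  using Comp_assoc[of f _ _ g _ h] assms by (simp add: hom_iff)

lemma Ident_left [simp]: "\<lbrakk> f \<in> Arr C; Cod C f = Y \<rbrakk> \<Longrightarrow> \<one> Y \<cdot> f = f"
  using Ident_Comp[of f _ Y] by (simp add: hom_iff)

lemma Ident_right [simp]: "\<lbrakk> f \<in> Arr C; Dom C f = X \<rbrakk> \<Longrightarrow> f \<cdot> \<one> X = f"
  using Comp_Ident[of f X] by (simp add: hom_iff)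

lemma inverse_arrows_unique:
  assumes "inverse_arrows C f g" "inverse_arrows C f g'"
  shows "g = g'"
proof -
  have "g = g \<cdot> (f \<cdot> g')" "(g \<cdot> f) \<cdot> g' = g'"
    using assms by (simp_all add: inverse_arrows_def hom_iff)
  moreover have "(g \<cdot> f) \<cdot> g' = g \<cdot> (f \<cdot> g')"
    using assms by (intro assoc_arr) (simp_all add: inverse_arrows_def hom_iff)
  ultimately show ?thesis by metis
qed

lemma inverse_inv_arrow: "is_iso C f \<Longrightarrow> inverse_arrows C f (inv_arrow C f)"
  unfolding is_iso_def inv_arrow_def by (metis theI inverse_arrows_unique)

lemma is_iso_arr: "is_iso C f \<Longrightarrow> f \<in> Arr C"
  by (auto simp: is_iso_def inverse_arrows_def)

lemma inv_arr [simp]: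
  assumes "is_iso C f"
  shows "inv_arrow C f \<in> Arr C" "Dom C (inv_arrow C f) = Cod C f" "Cod C (inv_arrow C f) = Dom C f"
    "inv_arrow C f \<cdot> f = \<one> (Dom C f)" "f \<cdot> inv_arrow C f = \<one> (Cod C f)"
  using inverse_inv_arrow[OF assms] by (simp_all add: inverse_arrows_def hom_iff)

lemma inv_cancel [simp]:
  assumes "is_iso C f" "h \<in> Arr C"
  shows "Cod C h = Dom C f \<Longrightarrow> inv_arrow C f \<cdot> f \<cdot> h = h"
    "Cod C h = Cod C f \<Longrightarrow> f \<cdot> inv_arrow C f \<cdot> h = h"
  using assms is_iso_arr[OF assms(1)] by (simp_all flip: assoc_arr)

lemma iso_cancel_left:
  assumes "is_iso C f" "f \<cdot> g = f \<cdot> h" "g \<in> Arr C" "h \<in> Arr C" "Cod C g = Dom C f" "Cod C h = Dom C f"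
  shows "g = h"
  using assms inv_cancel(1)[of f] by metis

lemma iso_cancel_right:
  assumes "is_iso C f" "g \<cdot> f = h \<cdot> f" "g \<in> Arr C" "h \<in> Arr C" "Dom C g = Cod C f" "Dom C h = Cod C f"
  shows "g = h"
proof -
  have "(g \<cdot> f) \<cdot> inv_arrow C f = (h \<cdot> f) \<cdot> inv_arrow C f" using assms by simp
  then show ?thesis using assms(1,3-) is_iso_arr[OF assms(1)] by simp
qed

lemma is_isoI:
  assumes "f \<in> Arr C" "g \<in> Arr C" "Dom C g = Cod C f" "Cod C g = Dom C f"
    "g \<cdot> f = \<one> (Dom C f)" "f \<cdot> g = \<one> (Cod C f)"
  shows "is_iso C f"
  using assms unfolding is_iso_def inverse_arrows_def hom_iff by blast

end

section \<open>Coherence\<close>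

context monoidal_category
begin

lemma tensor_obj [simp]: "\<lbrakk> X \<in> Obj C; Y \<in> Obj C \<rbrakk> \<Longrightarrow> X \<otimes>\<^sub>o Y \<in> Obj C" "\<I> \<in> Obj C"
  by (fact TensorObj_Obj Unit_Obj)+

lemma tensor_arr [simp]:
  assumes "f \<in> Arr C" "g \<in> Arr C"
  shows "f \<otimes> g \<in> Arr C" "Dom C (f \<otimes> g) = Dom C f \<otimes>\<^sub>o Dom C g"
    "Cod C (f \<otimes> g) = Cod C f \<otimes>\<^sub>o Cod C g"
  using Tensor_hom[of f _ _ g] assms by (simp_all add: hom_iff)

text \<open>
  Used from left to right, the interchange law merges adjacent tensor products into one; this is the
  normal form on which the calculations below rely.
\<close>

lemma interchange [simp]:
  assumes "f \<in> Arr C" "g \<in> Arr C" "f' \<in> Arr C" "g' \<in> Arr C" "Dom C f' = Cod C f" "Dom C g' = Cod C g"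
  shows "(f' \<otimes> g') \<cdot> (f \<otimes> g) = (f' \<cdot> f) \<otimes> (g' \<cdot> g)"
  using Tensor_Comp[of f _ _ f' _ g _ _ g'] assms by (simp add: hom_iff)

lemma interchange_assoc [simp]:
  assumes "f \<in> Arr C" "g \<in> Arr C" "f' \<in> Arr C" "g' \<in> Arr C" "Dom C f' = Cod C f" "Dom C g' = Cod C g"
    "h \<in> Arr C" "Cod C h = Dom C f \<otimes>\<^sub>o Dom C g"
  shows "(f' \<otimes> g') \<cdot> (f \<otimes> g) \<cdot> h = ((f' \<cdot> f) \<otimes> (g' \<cdot> g)) \<cdot> h"
  using assms by (simp flip: assoc_arr)

lemma coherence_arr [simp]:
  assumes "X \<in> Obj C"
  shows "Lunit C X \<in> Arr C" "Dom C (Lunit C X) = \<I> \<otimes>\<^sub>o X" "Cod C (Lunit C X) = X"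
    "Runit C X \<in> Arr C" "Dom C (Runit C X) = X \<otimes>\<^sub>o \<I>" "Cod C (Runit C X) = X"
    "is_iso C (Lunit C X)" "is_iso C (Runit C X)"
  using Lunit_hom[OF assms] Runit_hom[OF assms] Lunit_iso[OF assms] Runit_iso[OF assms]
  by (simp_all add: hom_iff)

lemma Assoc_arr [simp]:
  assumes "X \<in> Obj C" "Y \<in> Obj C" "Z \<in> Obj C"
  shows "Assoc C X Y Z \<in> Arr C" "Dom C (Assoc C X Y Z) = (X \<otimes>\<^sub>o Y) \<otimes>\<^sub>o Z"
    "Cod C (Assoc C X Y Z) = X \<otimes>\<^sub>o (Y \<otimes>\<^sub>o Z)" "is_iso C (Assoc C X Y Z)"
  using Assoc_hom[OF assms] Assoc_iso[OF assms] by (simp_all add: hom_iff)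

lemma Assoc_nat:
  assumes "f \<in> Arr C" "g \<in> Arr C" "h \<in> Arr C" "Cod C f = X" "Cod C g = Y" "Cod C h = Z"
  shows "Assoc C X Y Z \<cdot> ((f \<otimes> g) \<otimes> h) = (f \<otimes> (g \<otimes> h)) \<cdot> Assoc C (Dom C f) (Dom C g) (Dom C h)"
  using Assoc_natural[of f _ _ g _ _ h] assms by (simp add: hom_iff)

lemma inv_Assoc_nat:
  assumes "f \<in> Arr C" "g \<in> Arr C" "h \<in> Arr C" "Dom C f = X" "Dom C g = Y" "Dom C h = Z"
  shows "inv_arrow C (Assoc C (Cod C f) (Cod C g) (Cod C h)) \<cdot> (f \<otimes> (g \<otimes> h))
    = ((f \<otimes> g) \<otimes> h) \<cdot> inv_arrow C (Assoc C X Y Z)"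
proof -
  let ?A = "Assoc C X Y Z" and ?B = "Assoc C (Cod C f) (Cod C g) (Cod C h)"
  have "?B \<cdot> ((f \<otimes> g) \<otimes> h) = (f \<otimes> (g \<otimes> h)) \<cdot> ?A"
    using assms by (subst Assoc_nat) simp_all
  then have "inv_arrow C ?B \<cdot> (?B \<cdot> ((f \<otimes> g) \<otimes> h)) \<cdot> inv_arrow C ?A
      = inv_arrow C ?B \<cdot> ((f \<otimes> (g \<otimes> h)) \<cdot> ?A) \<cdot> inv_arrow C ?A"
    by (rule arg_cong)
  then show ?thesis using assms by (auto simp del: interchange interchange_assoc)
qed

lemma Lunit_nat: "\<lbrakk> f \<in> Arr C; Cod C f = Y \<rbrakk> \<Longrightarrow> Lunit C Y \<cdot> (\<one> \<I> \<otimes> f) = f \<cdot> Lunit C (Dom C f)"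
  using Lunit_natural[of f _ Y] by (simp add: hom_iff)

lemma Runit_nat: "\<lbrakk> f \<in> Arr C; Cod C f = Y \<rbrakk> \<Longrightarrow> Runit C Y \<cdot> (f \<otimes> \<one> \<I>) = f \<cdot> Runit C (Dom C f)"
  using Runit_natural[of f _ Y] by (simp add: hom_iff)

text \<open>
  The unitors are natural isomorphisms from \<open>\<I> \<otimes> _\<close> and \<open>_ \<otimes> \<I>\<close> to the identity functor.
\<close>

lemma unit_tensor_faithful:
  assumes "f \<in> Arr C" "g \<in> Arr C" "Dom C f = Dom C g" "Cod C f = Cod C g"
  shows "\<one> \<I> \<otimes> f = \<one> \<I> \<otimes> g \<Longrightarrow> f = g" "f \<otimes> \<one> \<I> = g \<otimes> \<one> \<I> \<Longrightarrow> f = g"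
proof -
  assume "\<one> \<I> \<otimes> f = \<one> \<I> \<otimes> g"
  then have "f \<cdot> Lunit C (Dom C f) = g \<cdot> Lunit C (Dom C f)"
    using assms by (metis Lunit_nat)
  then show "f = g" by (rule iso_cancel_right[rotated]) (use assms in simp_all)
next
  assume "f \<otimes> \<one> \<I> = g \<otimes> \<one> \<I>"
  then have "f \<cdot> Runit C (Dom C f) = g \<cdot> Runit C (Dom C f)"
    using assms by (metis Runit_nat)
  then show "f = g" by (rule iso_cancel_right[rotated]) (use assms in simp_all)
qed

lemma is_iso_tensor:
  assumes "is_iso C f" "is_iso C g"
  shows "is_iso C (f \<otimes> g)"
  using assms is_iso_arr[OF assms(1)] is_iso_arr[OF assms(2)]
  by (intro is_isoI[of _ "inv_arrow C f \<otimes> inv_arrow C g"]) (simp_all add: Tensor_Ident)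

text \<open>
  Kelly's argument: by the triangle identity and the naturality of associators, the pentagon at
  \<open>W, X, \<I>, \<I>\<close> shows that the two sides agree once they are tensored with \<open>\<one> \<I>\<close> and followed by
  \<open>Assoc C W X \<I>\<close>. The associator is invertible and tensoring with \<open>\<one> \<I>\<close> is faithful.
\<close>

lemma Runit_tensor:
  assumes W: "W \<in> Obj C" and X: "X \<in> Obj C"
  shows "(\<one> W \<otimes> Runit C X) \<cdot> Assoc C W X \<I> = Runit C (W \<otimes>\<^sub>o X)"
proof -
  have "Assoc C W X \<I> \<cdot> (Runit C (W \<otimes>\<^sub>o X) \<otimes> \<one> \<I>)
      = Assoc C W X \<I> \<cdot> ((\<one> W \<otimes> \<one> X) \<otimes> Lunit C \<I>) \<cdot> Assoc C (W \<otimes>\<^sub>o X) \<I> \<I>"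
    using assms by (simp add: triangle Tensor_Ident)
  also have "\<dots> = (Assoc C W X \<I> \<cdot> ((\<one> W \<otimes> \<one> X) \<otimes> Lunit C \<I>)) \<cdot> Assoc C (W \<otimes>\<^sub>o X) \<I> \<I>"
    using assms by simp
  also have "\<dots> = (\<one> W \<otimes> (\<one> X \<otimes> Lunit C \<I>)) \<cdot> Assoc C W X (\<I> \<otimes>\<^sub>o \<I>) \<cdot> Assoc C (W \<otimes>\<^sub>o X) \<I> \<I>"
    using assms by (subst Assoc_nat) simp_all
  also have "\<dots> = (\<one> W \<otimes> (Runit C X \<otimes> \<one> \<I>)) \<cdot> Assoc C W (X \<otimes>\<^sub>o \<I>) \<I> \<cdot> (Assoc C W X \<I> \<otimes> \<one> \<I>)"
    using assms by (simp add: pentagon triangle)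
  also have "\<dots> = (Assoc C W X \<I> \<cdot> ((\<one> W \<otimes> Runit C X) \<otimes> \<one> \<I>)) \<cdot> (Assoc C W X \<I> \<otimes> \<one> \<I>)"
    using assms by (subst Assoc_nat) simp_all
  also have "\<dots> = Assoc C W X \<I> \<cdot> (((\<one> W \<otimes> Runit C X) \<cdot> Assoc C W X \<I>) \<otimes> \<one> \<I>)"
    using assms by simp
  finally have "Runit C (W \<otimes>\<^sub>o X) \<otimes> \<one> \<I> = ((\<one> W \<otimes> Runit C X) \<cdot> Assoc C W X \<I>) \<otimes> \<one> \<I>"
    by (rule iso_cancel_left[rotated]) (use assms in simp_all)
  then show ?thesis
    by (rule unit_tensor_faithful(2)[symmetric, rotated -1]) (use assms in simp_all)
qed

text \<open>
  The mirror image of the preceding argument, with the pentagon at \<open>\<I>, \<I>, X, Y\<close>.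
\<close>

lemma Lunit_tensor:
  assumes X: "X \<in> Obj C" and Y: "Y \<in> Obj C"
  shows "Lunit C (X \<otimes>\<^sub>o Y) \<cdot> Assoc C \<I> X Y = Lunit C X \<otimes> \<one> Y"
proof -
  let ?Q = "Assoc C \<I> (\<I> \<otimes>\<^sub>o X) Y \<cdot> (Assoc C \<I> \<I> X \<otimes> \<one> Y)"
  have "(\<one> \<I> \<otimes> (Lunit C (X \<otimes>\<^sub>o Y) \<cdot> Assoc C \<I> X Y)) \<cdot> ?Q
      = (\<one> \<I> \<otimes> Lunit C (X \<otimes>\<^sub>o Y)) \<cdot> (\<one> \<I> \<otimes> Assoc C \<I> X Y) \<cdot> ?Q"
    using assms by simp
  also have "\<dots> = (\<one> \<I> \<otimes> Lunit C (X \<otimes>\<^sub>o Y)) \<cdot> Assoc C \<I> \<I> (X \<otimes>\<^sub>o Y) \<cdot> Assoc C (\<I> \<otimes>\<^sub>o \<I>) X Y"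
    using assms by (simp only: pentagon tensor_obj)
  also have "\<dots> = ((\<one> \<I> \<otimes> Lunit C (X \<otimes>\<^sub>o Y)) \<cdot> Assoc C \<I> \<I> (X \<otimes>\<^sub>o Y)) \<cdot> Assoc C (\<I> \<otimes>\<^sub>o \<I>) X Y"
    using assms by simp
  also have "\<dots> = (Runit C \<I> \<otimes> (\<one> X \<otimes> \<one> Y)) \<cdot> Assoc C (\<I> \<otimes>\<^sub>o \<I>) X Y"
    using assms by (simp add: triangle Tensor_Ident)
  also have "\<dots> = Assoc C \<I> X Y \<cdot> ((Runit C \<I> \<otimes> \<one> X) \<otimes> \<one> Y)"
    using assms by (subst Assoc_nat) simp_all
  also have "\<dots> = (Assoc C \<I> X Y \<cdot> ((\<one> \<I> \<otimes> Lunit C X) \<otimes> \<one> Y)) \<cdot> (Assoc C \<I> \<I> X \<otimes> \<one> Y)"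
    using assms by (simp add: triangle)
  also have "\<dots> = (\<one> \<I> \<otimes> (Lunit C X \<otimes> \<one> Y)) \<cdot> ?Q"
    using assms by (subst Assoc_nat) simp_all
  finally have E: "(\<one> \<I> \<otimes> (Lunit C (X \<otimes>\<^sub>o Y) \<cdot> Assoc C \<I> X Y)) \<cdot> ?Q = (\<one> \<I> \<otimes> (Lunit C X \<otimes> \<one> Y)) \<cdot> ?Q" .
  have "((\<one> \<I> \<otimes> (Lunit C (X \<otimes>\<^sub>o Y) \<cdot> Assoc C \<I> X Y)) \<cdot> Assoc C \<I> (\<I> \<otimes>\<^sub>o X) Y)
      = ((\<one> \<I> \<otimes> (Lunit C X \<otimes> \<one> Y)) \<cdot> Assoc C \<I> (\<I> \<otimes>\<^sub>o X) Y)"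
    by (rule iso_cancel_right[of "Assoc C \<I> \<I> X \<otimes> \<one> Y"])
      (use assms E in \<open>simp_all add: is_iso_tensor is_isoI[of _ "\<one> Y"]\<close>)
  then have "\<one> \<I> \<otimes> (Lunit C (X \<otimes>\<^sub>o Y) \<cdot> Assoc C \<I> X Y) = \<one> \<I> \<otimes> (Lunit C X \<otimes> \<one> Y)"
    by (rule iso_cancel_right[rotated]) (use assms in simp_all)
  then show ?thesis
    by (rule unit_tensor_faithful(1)[rotated -1]) (use assms in simp_all)
qed

end

context symmetric_monoidal_category
begin

lemma Swap_arr [simp]:
  assumes "X \<in> Obj C" "Y \<in> Obj C"
  shows "Swap C X Y \<in> Arr C" "Dom C (Swap C X Y) = X \<otimes>\<^sub>o Y" "Cod C (Swap C X Y) = Y \<otimes>\<^sub>o X"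
    "Swap C Y X \<cdot> Swap C X Y = \<one> (X \<otimes>\<^sub>o Y)"
  using Swap_hom[OF assms] Swap_Swap[OF assms] by (simp_all add: hom_iff)

lemma Swap_cancel [simp]:
  "\<lbrakk> X \<in> Obj C; Y \<in> Obj C; h \<in> Arr C; Cod C h = X \<otimes>\<^sub>o Y \<rbrakk> \<Longrightarrow> Swap C Y X \<cdot> Swap C X Y \<cdot> h = h"
  by (simp flip: assoc_arr)

lemma Swap_nat:
  assumes "f \<in> Arr C" "g \<in> Arr C" "Cod C f = X" "Cod C g = Y"
  shows "Swap C X Y \<cdot> (f \<otimes> g) = (g \<otimes> f) \<cdot> Swap C (Dom C f) (Dom C g)"
  using Swap_natural[of f _ X g _ Y] assms by (simp add: hom_iff)

lemma is_iso_Swap [simp]: "\<lbrakk> X \<in> Obj C; Y \<in> Obj C \<rbrakk> \<Longrightarrow> is_iso C (Swap C X Y)"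
  by (rule is_isoI[of _ "Swap C Y X"]) simp_all

text \<open>
  The hexagon at \<open>Z, X, Y\<close>, read backwards: it expresses the symmetry that moves the third of three
  factors to the front, while the original one moves the first to the back.
\<close>

lemma hexagon_inverse:
  assumes "X \<in> Obj C" "Y \<in> Obj C" "Z \<in> Obj C"
  shows "Assoc C Z X Y \<cdot> (Swap C X Z \<otimes> \<one> Y) \<cdot> inv_arrow C (Assoc C X Z Y) \<cdot> (\<one> X \<otimes> Swap C Y Z)
    = Swap C (X \<otimes>\<^sub>o Y) Z \<cdot> inv_arrow C (Assoc C X Y Z)"  (is "?L = ?R")
proof -
  let ?H = "Assoc C X Y Z \<cdot> Swap C Z (X \<otimes>\<^sub>o Y) \<cdot> Assoc C Z X Y"
  have H: "?H = (\<one> X \<otimes> Swap C Z Y) \<cdot> Assoc C X Z Y \<cdot> (Swap C Z X \<otimes> \<one> Y)"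
    using assms by (simp add: hexagon)
  have "?H \<cdot> inv_arrow C (Assoc C Z X Y) \<cdot> ?L = \<one> (X \<otimes>\<^sub>o (Y \<otimes>\<^sub>o Z))"
    unfolding H using assms by (simp add: Tensor_Ident)
  then have "Assoc C X Y Z \<cdot> Swap C Z (X \<otimes>\<^sub>o Y) \<cdot> ?L = Assoc C X Y Z \<cdot> Swap C Z (X \<otimes>\<^sub>o Y) \<cdot> ?R"
    using assms by simp
  then have "Swap C Z (X \<otimes>\<^sub>o Y) \<cdot> ?L = Swap C Z (X \<otimes>\<^sub>o Y) \<cdot> ?R"
    by (rule iso_cancel_left[rotated]) (use assms in simp_all)
  then show ?thesis
    by (rule iso_cancel_left[rotated]) (use assms in simp_all)
qed

text \<open>
  The symmetry \<open>((x, y), z) \<mapsto> ((x, z), y)\<close>.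
\<close>

definition rearrange :: "'o \<Rightarrow> 'o \<Rightarrow> 'o \<Rightarrow> 'm"
  where "rearrange X Y Z = inv_arrow C (Assoc C X Z Y) \<cdot> (\<one> X \<otimes> Swap C Y Z) \<cdot> Assoc C X Y Z"

lemma rearrange_arr [simp]:
  assumes "X \<in> Obj C" "Y \<in> Obj C" "Z \<in> Obj C"
  shows "rearrange X Y Z \<in> Arr C" "Dom C (rearrange X Y Z) = (X \<otimes>\<^sub>o Y) \<otimes>\<^sub>o Z"
    "Cod C (rearrange X Y Z) = (X \<otimes>\<^sub>o Z) \<otimes>\<^sub>o Y"
  using assms by (simp_all add: rearrange_def)

lemma rearrange_nat:
  assumes "X \<in> Obj C" "Z \<in> Obj C" "h \<in> Arr C" "Cod C h = Y"
  shows "(\<one> (X \<otimes>\<^sub>o Z) \<otimes> h) \<cdot> rearrange X (Dom C h) Z = rearrange X Y Z \<cdot> ((\<one> X \<otimes> h) \<otimes> \<one> Z)"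
proof -
  have "rearrange X Y Z \<cdot> ((\<one> X \<otimes> h) \<otimes> \<one> Z)
      = inv_arrow C (Assoc C X Z Y) \<cdot> (\<one> X \<otimes> Swap C Y Z) \<cdot> Assoc C X Y Z \<cdot> ((\<one> X \<otimes> h) \<otimes> \<one> Z)"
    using assms by (auto simp add: rearrange_def)
  also have "\<dots> = inv_arrow C (Assoc C X Z Y) \<cdot> (\<one> X \<otimes> (Swap C Y Z \<cdot> (h \<otimes> \<one> Z))) \<cdot> Assoc C X (Dom C h) Z"
    using assms by (subst Assoc_nat) auto
  also have "\<dots> = (inv_arrow C (Assoc C X Z Y) \<cdot> (\<one> X \<otimes> (\<one> Z \<otimes> h))) \<cdot> (\<one> X \<otimes> Swap C (Dom C h) Z) \<cdot> Assoc C X (Dom C h) Z"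
    using assms by (subst Swap_nat) auto
  also have "inv_arrow C (Assoc C X Z Y) \<cdot> (\<one> X \<otimes> (\<one> Z \<otimes> h)) = (\<one> (X \<otimes>\<^sub>o Z) \<otimes> h) \<cdot> inv_arrow C (Assoc C X Z (Dom C h))"
    using assms inv_Assoc_nat[of "\<one> X" "\<one> Z" h X Z "Dom C h"] by (simp add: Tensor_Ident)
  finally show ?thesis using assms by (auto simp add: rearrange_def)
qed

text \<open>
  On elements, both sides send \<open>((x, x'), (y, y'))\<close> to \<open>((x, y), (x', y'))\<close>; the right-hand side
  goes through \<open>((x, x'), (y', y))\<close> and \<open>((x, (x', y')), y)\<close>. Its point is that everything
  except one copy of \<open>y\<close> is grouped together, as in a conditional with an input from
  \<open>X \<otimes> Y\<close>. The leading swap is absorbed later by the commutativity of copying.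
\<close>

lemma mid_swap_rearrange:
  assumes X: "X \<in> Obj C" and Y: "Y \<in> Obj C"
  shows "mid_swap C X Y = rearrange X (X \<otimes>\<^sub>o Y) Y \<cdot> (Assoc C X X Y \<otimes> \<one> Y) \<cdot>
    inv_arrow C (Assoc C (X \<otimes>\<^sub>o X) Y Y) \<cdot> (\<one> (X \<otimes>\<^sub>o X) \<otimes> Swap C Y Y)"
proof -
  \<comment> \<open>The second pair of factors is regrouped by the pentagon.\<close>
  have pent: "Assoc C X (X \<otimes>\<^sub>o Y) Y \<cdot> (Assoc C X X Y \<otimes> \<one> Y) \<cdot> inv_arrow C (Assoc C (X \<otimes>\<^sub>o X) Y Y)
      = (\<one> X \<otimes> inv_arrow C (Assoc C X Y Y)) \<cdot> Assoc C X X (Y \<otimes>\<^sub>o Y)"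
  proof -
    let ?I = "\<one> X \<otimes> inv_arrow C (Assoc C X Y Y)" and ?J = "inv_arrow C (Assoc C (X \<otimes>\<^sub>o X) Y Y)"
    have "?I \<cdot> ((\<one> X \<otimes> Assoc C X Y Y) \<cdot> Assoc C X (X \<otimes>\<^sub>o Y) Y \<cdot> (Assoc C X X Y \<otimes> \<one> Y)) \<cdot> ?J
        = ?I \<cdot> (Assoc C X X (Y \<otimes>\<^sub>o Y) \<cdot> Assoc C (X \<otimes>\<^sub>o X) Y Y) \<cdot> ?J"
      using assms by (simp only: pentagon tensor_obj)
    then show ?thesis using assms by (simp add: Tensor_Ident)
  qed
  have nat: "(\<one> X \<otimes> (\<one> X \<otimes> Swap C Y Y)) \<cdot> Assoc C X X (Y \<otimes>\<^sub>o Y)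
      = Assoc C X X (Y \<otimes>\<^sub>o Y) \<cdot> (\<one> (X \<otimes>\<^sub>o X) \<otimes> Swap C Y Y)"
    using assms Assoc_nat[of "\<one> X" "\<one> X" "Swap C Y Y" X X] by (simp add: Tensor_Ident)
  \<comment> \<open>The inner symmetry of \<open>mid_swap\<close> moves the last copy instead, after a swap of the two copies.\<close>
  have hex: "Assoc C Y X Y \<cdot> (Swap C X Y \<otimes> \<one> Y) \<cdot> inv_arrow C (Assoc C X Y Y)
      = Swap C (X \<otimes>\<^sub>o Y) Y \<cdot> inv_arrow C (Assoc C X Y Y) \<cdot> (\<one> X \<otimes> Swap C Y Y)"
  proof -
    have "(Assoc C Y X Y \<cdot> (Swap C X Y \<otimes> \<one> Y) \<cdot> inv_arrow C (Assoc C X Y Y) \<cdot> (\<one> X \<otimes> Swap C Y Y)) \<cdot> (\<one> X \<otimes> Swap C Y Y)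
       = (Swap C (X \<otimes>\<^sub>o Y) Y \<cdot> inv_arrow C (Assoc C X Y Y)) \<cdot> (\<one> X \<otimes> Swap C Y Y)"
      using assms by (simp only: hexagon_inverse)
    then show ?thesis using assms by (simp add: Tensor_Ident)
  qed
  have "mid_swap C X Y = inv_arrow C (Assoc C X Y (X \<otimes>\<^sub>o Y)) \<cdot>
      (\<one> X \<otimes> (Swap C (X \<otimes>\<^sub>o Y) Y \<cdot> inv_arrow C (Assoc C X Y Y) \<cdot> (\<one> X \<otimes> Swap C Y Y))) \<cdot> Assoc C X X (Y \<otimes>\<^sub>o Y)"
    unfolding mid_swap_def by (simp only: hex)
  also have "\<dots> = inv_arrow C (Assoc C X Y (X \<otimes>\<^sub>o Y)) \<cdot> (\<one> X \<otimes> Swap C (X \<otimes>\<^sub>o Y) Y) \<cdot>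
      (\<one> X \<otimes> inv_arrow C (Assoc C X Y Y)) \<cdot> (\<one> X \<otimes> (\<one> X \<otimes> Swap C Y Y)) \<cdot> Assoc C X X (Y \<otimes>\<^sub>o Y)"
    using assms by simp
  also have "\<dots> = inv_arrow C (Assoc C X Y (X \<otimes>\<^sub>o Y)) \<cdot> (\<one> X \<otimes> Swap C (X \<otimes>\<^sub>o Y) Y) \<cdot>
      ((\<one> X \<otimes> inv_arrow C (Assoc C X Y Y)) \<cdot> Assoc C X X (Y \<otimes>\<^sub>o Y)) \<cdot> (\<one> (X \<otimes>\<^sub>o X) \<otimes> Swap C Y Y)"
    unfolding nat using assms by (simp add: Tensor_Ident)
  finally show ?thesis
    unfolding pent[symmetric] rearrange_def using assms by simp
qed

end

section \<open>Projections, graphs and copying\<close>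

context markov_category
begin

lemma Copy_arr [simp]:
  assumes "X \<in> Obj C"
  shows "Copy C X \<in> Arr C" "Dom C (Copy C X) = X" "Cod C (Copy C X) = X \<otimes>\<^sub>o X"
  using Copy_hom[OF assms] by (simp_all add: hom_iff)

lemma Del_arr [simp]:
  assumes "X \<in> Obj C"
  shows "Del C X \<in> Arr C" "Dom C (Del C X) = X" "Cod C (Del C X) = \<I>"
  using Del_hom[OF assms] by (simp_all add: hom_iff)

lemma Del_nat [simp]: "\<lbrakk> f \<in> Arr C; Cod C f = Y \<rbrakk> \<Longrightarrow> Del C Y \<cdot> f = Del C (Dom C f)"
  using Del_natural[of f _ Y] by (simp add: hom_iff)

definition proj1 :: "'o \<Rightarrow> 'o \<Rightarrow> 'm"
  where "proj1 X Y = Runit C X \<cdot> (\<one> X \<otimes> Del C Y)"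

definition proj2 :: "'o \<Rightarrow> 'o \<Rightarrow> 'm"
  where "proj2 X Y = Lunit C Y \<cdot> (Del C X \<otimes> \<one> Y)"

lemma proj_arr [simp]:
  assumes "X \<in> Obj C" "Y \<in> Obj C"
  shows "proj1 X Y \<in> Arr C" "Dom C (proj1 X Y) = X \<otimes>\<^sub>o Y" "Cod C (proj1 X Y) = X"
    "proj2 X Y \<in> Arr C" "Dom C (proj2 X Y) = X \<otimes>\<^sub>o Y" "Cod C (proj2 X Y) = Y"
  using assms by (simp_all add: proj1_def proj2_def)

lemma marginal_proj1:
  assumes "X \<in> Obj C" "Y \<in> Obj C" "f \<in> Arr C" "Cod C f = X \<otimes>\<^sub>o Y"
  shows "marginal C X Y f = proj1 X Y \<cdot> f"
  using assms by (simp add: marginal_def proj1_def)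

lemma proj1_copy: "X \<in> Obj C \<Longrightarrow> proj1 X X \<cdot> Copy C X = \<one> X"
  by (simp add: proj1_def Copy_Runit)

lemma proj2_copy: "X \<in> Obj C \<Longrightarrow> proj2 X X \<cdot> Copy C X = \<one> X"
  by (simp add: proj2_def Copy_Lunit)

lemma proj1_nat:
  assumes "f \<in> Arr C" "g \<in> Arr C" "Cod C f = X" "Cod C g = Y"
  shows "proj1 X Y \<cdot> (f \<otimes> g) = f \<cdot> proj1 (Dom C f) (Dom C g)"
proof -
  have "proj1 X Y \<cdot> (f \<otimes> g) = (Runit C X \<cdot> (f \<otimes> \<one> \<I>)) \<cdot> (\<one> (Dom C f) \<otimes> Del C (Dom C g))"
    using assms by (auto simp add: proj1_def)
  also have "\<dots> = f \<cdot> proj1 (Dom C f) (Dom C g)"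
    using assms by (subst Runit_nat) (auto simp add: proj1_def)
  finally show ?thesis .
qed

lemma proj2_nat:
  assumes "f \<in> Arr C" "g \<in> Arr C" "Cod C f = X" "Cod C g = Y"
  shows "proj2 X Y \<cdot> (f \<otimes> g) = g \<cdot> proj2 (Dom C f) (Dom C g)"
proof -
  have "proj2 X Y \<cdot> (f \<otimes> g) = (Lunit C Y \<cdot> (\<one> \<I> \<otimes> g)) \<cdot> (Del C (Dom C f) \<otimes> \<one> (Dom C g))"
    using assms by (auto simp add: proj2_def)
  also have "\<dots> = g \<cdot> proj2 (Dom C f) (Dom C g)"
    using assms by (subst Lunit_nat) (auto simp add: proj2_def)
  finally show ?thesis .
qed

text \<open>
  In a symmetric monoidal category this coherence law needs the hexagon. Here it follows from the
  counit laws: \<open>(\<one> X \<otimes> Del C X) \<cdot> Copy C X\<close> is inverse to \<open>Runit C X\<close>, and both sides invert it,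
  as copying is commutative.
\<close>

lemma Lunit_Swap:
  assumes X: "X \<in> Obj C"
  shows "Lunit C X \<cdot> Swap C X \<I> = Runit C X"
proof -
  let ?c = "(\<one> X \<otimes> Del C X) \<cdot> Copy C X"
  have inv: "Runit C X \<cdot> ?c = \<one> X" using X by (simp add: Copy_Runit)
  have iso: "is_iso C ?c"
  proof -
    have "Runit C X \<cdot> (?c \<cdot> Runit C X) = Runit C X \<cdot> \<one> (X \<otimes>\<^sub>o \<I>)"
    proof -
      have "(Runit C X \<cdot> ?c) \<cdot> Runit C X = Runit C X" unfolding inv using X by simp
      then show ?thesis using X by simp
    qed
    then have "?c \<cdot> Runit C X = \<one> (X \<otimes>\<^sub>o \<I>)"
      by (rule iso_cancel_left[rotated]) (use X in simp_all)
    then show ?thesis using inv X by (intro is_isoI[of _ "Runit C X"]) simp_all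
  qed
  have "(Lunit C X \<cdot> Swap C X \<I>) \<cdot> ?c = Lunit C X \<cdot> (Swap C X \<I> \<cdot> (\<one> X \<otimes> Del C X)) \<cdot> Copy C X"
    using X by simp
  also have "\<dots> = Lunit C X \<cdot> (Del C X \<otimes> \<one> X) \<cdot> (Swap C X X \<cdot> Copy C X)"
    using X by (subst Swap_nat) simp_all
  also have "\<dots> = Runit C X \<cdot> ?c"
    using X by (simp only: Copy_comm Copy_Lunit Copy_Runit)
  finally show ?thesis
    by (rule iso_cancel_right[OF iso]) (use X in simp_all)
qed

lemma proj2_Swap:
  assumes "X \<in> Obj C" "Y \<in> Obj C"
  shows "proj2 Y X \<cdot> Swap C X Y = proj1 X Y"
proof -
  have "proj2 Y X \<cdot> Swap C X Y = Lunit C X \<cdot> Swap C X \<I> \<cdot> (\<one> X \<otimes> Del C Y)"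
    using assms by (subst Swap_nat) (simp_all add: proj2_def)
  also have "\<dots> = (Lunit C X \<cdot> Swap C X \<I>) \<cdot> (\<one> X \<otimes> Del C Y)"
    using assms by simp
  finally show ?thesis unfolding proj1_def using assms by (simp only: Lunit_Swap)
qed

lemma proj1_Assoc:
  assumes "X \<in> Obj C" "Y \<in> Obj C" "Z \<in> Obj C"
  shows "(\<one> X \<otimes> proj1 Y Z) \<cdot> Assoc C X Y Z = proj1 (X \<otimes>\<^sub>o Y) Z"
proof -
  have "(\<one> X \<otimes> proj1 Y Z) \<cdot> Assoc C X Y Z = (\<one> X \<otimes> Runit C Y) \<cdot> (\<one> X \<otimes> (\<one> Y \<otimes> Del C Z)) \<cdot> Assoc C X Y Z"
    using assms by (simp add: proj1_def)
  also have "\<dots> = (\<one> X \<otimes> Runit C Y) \<cdot> Assoc C X Y \<I> \<cdot> (\<one> (X \<otimes>\<^sub>o Y) \<otimes> Del C Z)"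
    using assms Assoc_nat[of "\<one> X" "\<one> Y" "Del C Z" X Y \<I>] by (simp add: Tensor_Ident)
  also have "\<dots> = ((\<one> X \<otimes> Runit C Y) \<cdot> Assoc C X Y \<I>) \<cdot> (\<one> (X \<otimes>\<^sub>o Y) \<otimes> Del C Z)"
    using assms by simp
  finally show ?thesis using assms by (simp add: Runit_tensor proj1_def)
qed

text \<open>
  Discarding a pair amounts to discarding its components one after the other, by the formula for
  \<open>Del\<close> of a tensor product.
\<close>

lemma proj1_tensor:
  assumes "X \<in> Obj C" "Y \<in> Obj C" "Z \<in> Obj C"
  shows "proj1 X (Y \<otimes>\<^sub>o Z) \<cdot> Assoc C X Y Z = proj1 X Y \<cdot> proj1 (X \<otimes>\<^sub>o Y) Z"
proof -
  have "proj1 X (Y \<otimes>\<^sub>o Z) \<cdot> Assoc C X Y Z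
      = Runit C X \<cdot> (\<one> X \<otimes> Lunit C \<I>) \<cdot> (\<one> X \<otimes> (Del C Y \<otimes> Del C Z)) \<cdot> Assoc C X Y Z"
    using assms by (simp add: proj1_def Del_Tensor del: Del_nat)
  also have "\<dots> = Runit C X \<cdot> (\<one> X \<otimes> Lunit C \<I>) \<cdot> Assoc C X \<I> \<I> \<cdot> ((\<one> X \<otimes> Del C Y) \<otimes> Del C Z)"
    using assms Assoc_nat[of "\<one> X" "Del C Y" "Del C Z" X \<I> \<I>] by simp
  also have "\<dots> = Runit C X \<cdot> ((\<one> X \<otimes> Lunit C \<I>) \<cdot> Assoc C X \<I> \<I>) \<cdot> ((\<one> X \<otimes> Del C Y) \<otimes> Del C Z)"
    using assms by simp
  also have "\<dots> = proj1 X Z \<cdot> (proj1 X Y \<otimes> \<one> Z)"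
    using assms by (simp add: triangle proj1_def)
  also have "\<dots> = proj1 X Y \<cdot> proj1 (X \<otimes>\<^sub>o Y) Z"
    using assms by (simp add: proj1_nat)
  finally show ?thesis .
qed

lemma proj2_Assoc:
  assumes "X \<in> Obj C" "Y \<in> Obj C" "Z \<in> Obj C"
  shows "proj2 X (Y \<otimes>\<^sub>o Z) \<cdot> Assoc C X Y Z = proj2 X Y \<otimes> \<one> Z"
proof -
  have "proj2 X (Y \<otimes>\<^sub>o Z) \<cdot> Assoc C X Y Z
      = Lunit C (Y \<otimes>\<^sub>o Z) \<cdot> (Del C X \<otimes> (\<one> Y \<otimes> \<one> Z)) \<cdot> Assoc C X Y Z"
    using assms by (simp add: proj2_def Tensor_Ident)
  also have "\<dots> = Lunit C (Y \<otimes>\<^sub>o Z) \<cdot> Assoc C \<I> Y Z \<cdot> ((Del C X \<otimes> \<one> Y) \<otimes> \<one> Z)"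
    using assms Assoc_nat[of "Del C X" "\<one> Y" "\<one> Z" \<I> Y Z] by simp
  also have "\<dots> = (Lunit C (Y \<otimes>\<^sub>o Z) \<cdot> Assoc C \<I> Y Z) \<cdot> ((Del C X \<otimes> \<one> Y) \<otimes> \<one> Z)"
    using assms by simp
  finally show ?thesis using assms by (simp add: Lunit_tensor proj2_def)
qed

lemma proj1_rearrange:
  assumes "X \<in> Obj C" "Y \<in> Obj C" "Z \<in> Obj C"
  shows "(proj1 X Z \<otimes> \<one> Y) \<cdot> rearrange X Y Z = proj1 (X \<otimes>\<^sub>o Y) Z"
proof -
  have 1: "(proj1 X Z \<otimes> \<one> Y) \<cdot> inv_arrow C (Assoc C X Z Y) = \<one> X \<otimes> proj2 Z Y"
  proof -
    have "(\<one> X \<otimes> proj2 Z Y) \<cdot> Assoc C X Z Y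
        = (\<one> X \<otimes> Lunit C Y) \<cdot> (\<one> X \<otimes> (Del C Z \<otimes> \<one> Y)) \<cdot> Assoc C X Z Y"
      using assms by (simp add: proj2_def)
    also have "\<dots> = (\<one> X \<otimes> Lunit C Y) \<cdot> Assoc C X \<I> Y \<cdot> ((\<one> X \<otimes> Del C Z) \<otimes> \<one> Y)"
      using assms Assoc_nat[of "\<one> X" "Del C Z" "\<one> Y" X \<I> Y] by simp
    also have "\<dots> = ((\<one> X \<otimes> Lunit C Y) \<cdot> Assoc C X \<I> Y) \<cdot> ((\<one> X \<otimes> Del C Z) \<otimes> \<one> Y)"
      using assms by simp
    also have "\<dots> = proj1 X Z \<otimes> \<one> Y"
      using assms by (simp add: triangle proj1_def)
    finally have E: "(\<one> X \<otimes> proj2 Z Y) \<cdot> Assoc C X Z Y = proj1 X Z \<otimes> \<one> Y" .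
    show ?thesis using assms by (simp flip: E)
  qed
  have "(proj1 X Z \<otimes> \<one> Y) \<cdot> rearrange X Y Z
      = ((proj1 X Z \<otimes> \<one> Y) \<cdot> inv_arrow C (Assoc C X Z Y)) \<cdot> (\<one> X \<otimes> Swap C Y Z) \<cdot> Assoc C X Y Z"
    using assms by (simp add: rearrange_def)
  also have "\<dots> = (\<one> X \<otimes> proj1 Y Z) \<cdot> Assoc C X Y Z"
    unfolding 1 using assms by (simp add: proj2_Swap)
  finally show ?thesis using assms by (simp add: proj1_Assoc)
qed

text \<open>
  In string diagrams, \<open>q\<close> together with an untouched copy of its input. This is how the input
  of \<open>q\<close> remains available to a conditional.
\<close>

definition graph :: "'m \<Rightarrow> 'm"
  where "graph q = (q \<otimes> \<one> (Dom C q)) \<cdot> Copy C (Dom C q)"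

lemma graph_arr [simp]:
  assumes "q \<in> Arr C"
  shows "graph q \<in> Arr C" "Dom C (graph q) = Dom C q" "Cod C (graph q) = Cod C q \<otimes>\<^sub>o Dom C q"
  using assms by (simp_all add: graph_def)

lemma proj1_graph:
  assumes "q \<in> Arr C" "Cod C q = X" "Dom C q = S"
  shows "proj1 X S \<cdot> graph q = q"
proof -
  have "proj1 X S \<cdot> graph q = (proj1 X S \<cdot> (q \<otimes> \<one> S)) \<cdot> Copy C S"
    using assms by (auto simp add: graph_def)
  also have "\<dots> = q \<cdot> proj1 S S \<cdot> Copy C S"
    using assms by (subst proj1_nat) auto
  finally show ?thesis using assms by (auto simp: proj1_copy)
qed

lemma graph_comp:
  assumes "q \<in> Arr C" "f \<in> Arr C" "Dom C f = Cod C q"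
  shows "graph (f \<cdot> q) = (f \<otimes> \<one> (Dom C q)) \<cdot> graph q"
  using assms by (simp add: graph_def)

text \<open>
  The operation \<open>(x, s) \<mapsto> (x, h(x, s))\<close>, which carries \<open>x\<close> along. With it, \<open>c\<close> being a conditional
  of \<open>f\<close> means that \<open>f\<close> is \<open>extend X S c\<close> after the graph of the marginal of \<open>f\<close>. All facts about
  conditionals used below are then facts about \<open>extend\<close>.
\<close>

definition extend :: "'o \<Rightarrow> 'o \<Rightarrow> 'm \<Rightarrow> 'm"
  where "extend X S h = (\<one> X \<otimes> h) \<cdot> Assoc C X X S \<cdot> (Copy C X \<otimes> \<one> S)"

lemma extend_arr [simp]:
  assumes "X \<in> Obj C" "S \<in> Obj C" "h \<in> Arr C" "Dom C h = X \<otimes>\<^sub>o S"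
  shows "extend X S h \<in> Arr C" "Dom C (extend X S h) = X \<otimes>\<^sub>o S" "Cod C (extend X S h) = X \<otimes>\<^sub>o Cod C h"
  using assms by (simp_all add: extend_def)

lemma conditionalD:
  assumes c: "conditional C S X Y f c" and obj: "X \<in> Obj C" "Y \<in> Obj C" "S \<in> Obj C"
  shows "c \<in> Arr C" "Dom C c = X \<otimes>\<^sub>o S" "Cod C c = Y" "f = extend X S c \<cdot> graph (proj1 X Y \<cdot> f)"
proof -
  have f: "f \<in> Arr C" "Dom C f = S" "Cod C f = X \<otimes>\<^sub>o Y"
    and c': "c \<in> Arr C" "Dom C c = X \<otimes>\<^sub>o S" "Cod C c = Y"
    using c by (simp_all add: conditional_def hom_iff)
  have "f = (\<one> X \<otimes> c) \<cdot> Assoc C X X S \<cdot> (Copy C X \<otimes> \<one> S) \<cdot> (marginal C X Y f \<otimes> \<one> S) \<cdot> Copy C S"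
    using c unfolding conditional_def by blast
  also have "\<dots> = extend X S c \<cdot> graph (proj1 X Y \<cdot> f)"
    using f c' obj by (simp add: marginal_proj1 extend_def graph_def)
  finally show "f = extend X S c \<cdot> graph (proj1 X Y \<cdot> f)" .
  show "c \<in> Arr C" "Dom C c = X \<otimes>\<^sub>o S" "Cod C c = Y" by fact+
qed

lemma comp_extend:
  assumes "X \<in> Obj C" "S \<in> Obj C" "h \<in> Arr C" "Dom C h = X \<otimes>\<^sub>o S" "f \<in> Arr C" "Dom C f = Cod C h"
  shows "(\<one> X \<otimes> f) \<cdot> extend X S h = extend X S (f \<cdot> h)"
  using assms by (simp add: extend_def)

lemma proj2_extend:
  assumes "X \<in> Obj C" "S \<in> Obj C" "h \<in> Arr C" "Dom C h = X \<otimes>\<^sub>o S" "Cod C h = Y"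
  shows "proj2 X Y \<cdot> extend X S h = h"
proof -
  have "proj2 X Y \<cdot> extend X S h = (proj2 X Y \<cdot> (\<one> X \<otimes> h)) \<cdot> Assoc C X X S \<cdot> (Copy C X \<otimes> \<one> S)"
    using assms by (auto simp add: extend_def)
  also have "\<dots> = h \<cdot> (proj2 X (X \<otimes>\<^sub>o S) \<cdot> Assoc C X X S) \<cdot> (Copy C X \<otimes> \<one> S)"
    using assms by (subst proj2_nat) auto
  also have "\<dots> = h"
    using assms by (simp add: proj2_Assoc proj2_copy Tensor_Ident)
  finally show ?thesis .
qed

lemma proj1_extend:
  assumes "X \<in> Obj C" "S \<in> Obj C" "h \<in> Arr C" "Dom C h = X \<otimes>\<^sub>o S" "Cod C h = Y"
  shows "proj1 X Y \<cdot> extend X S h = proj1 X S"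
proof -
  have "proj1 X Y \<cdot> extend X S h = (proj1 X Y \<cdot> (\<one> X \<otimes> h)) \<cdot> Assoc C X X S \<cdot> (Copy C X \<otimes> \<one> S)"
    using assms by (auto simp add: extend_def)
  also have "\<dots> = (proj1 X (X \<otimes>\<^sub>o S) \<cdot> Assoc C X X S) \<cdot> (Copy C X \<otimes> \<one> S)"
    using assms by (subst proj1_nat) auto
  also have "\<dots> = (proj1 X X \<cdot> Copy C X) \<cdot> proj1 X S"
    using assms by (simp add: proj1_tensor proj1_nat)
  finally show ?thesis using assms by (simp add: proj1_copy)
qed

lemma extend_proj1:
  assumes "X \<in> Obj C" "S \<in> Obj C" "u \<in> Arr C" "Dom C u = X"
  shows "extend X S (u \<cdot> proj1 X S) = (\<one> X \<otimes> u) \<cdot> Copy C X \<cdot> proj1 X S"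
proof -
  have "extend X S (u \<cdot> proj1 X S) = (\<one> X \<otimes> u) \<cdot> ((\<one> X \<otimes> proj1 X S) \<cdot> Assoc C X X S) \<cdot> (Copy C X \<otimes> \<one> S)"
    using assms by (auto simp add: extend_def)
  also have "\<dots> = (\<one> X \<otimes> u) \<cdot> Copy C X \<cdot> proj1 X S"
    using assms by (auto simp add: proj1_Assoc proj1_nat)
  finally show ?thesis .
qed

text \<open>
  Copying after a deterministic \<open>f\<close> is the same as copying before it. This is what allows \<open>y = f x\<close>
  to be conditioned on while \<open>x\<close> is retained.
\<close>

lemma deterministic_extend:
  assumes "deterministic C f" "S \<in> Obj C" "h \<in> Arr C" "Dom C h = Cod C f \<otimes>\<^sub>o S"
  shows "(f \<otimes> \<one> (Cod C h)) \<cdot> extend (Dom C f) S (h \<cdot> (f \<otimes> \<one> S)) = extend (Cod C f) S h \<cdot> (f \<otimes> \<one> S)"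
proof -
  let ?X = "Dom C f" and ?Y = "Cod C f"
  have f: "f \<in> Arr C" "Copy C ?Y \<cdot> f = (f \<otimes> f) \<cdot> Copy C ?X"
    using assms(1) by (simp_all add: deterministic_def)
  have "(f \<otimes> \<one> (Cod C h)) \<cdot> extend ?X S (h \<cdot> (f \<otimes> \<one> S))
      = (\<one> ?Y \<otimes> h) \<cdot> ((f \<otimes> (f \<otimes> \<one> S)) \<cdot> Assoc C ?X ?X S) \<cdot> (Copy C ?X \<otimes> \<one> S)"
    using assms f(1) by (simp add: extend_def)
  also have "(f \<otimes> (f \<otimes> \<one> S)) \<cdot> Assoc C ?X ?X S = Assoc C ?Y ?Y S \<cdot> ((f \<otimes> f) \<otimes> \<one> S)"
    using assms f(1) by (subst Assoc_nat) simp_all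
  finally show ?thesis using assms f by (simp add: extend_def)
qed

text \<open>
  To copy \<open>(x, s)\<close>, first copy \<open>s\<close>, set the second copy aside, and extend \<open>x\<close> by the pair
  \<open>(x, s)\<close>. Thus the copy map of a tensor product factors through \<open>extend\<close>.
\<close>

lemma Copy_tensor_extend:
  assumes X: "X \<in> Obj C" and S: "S \<in> Obj C"
  shows "Copy C (X \<otimes>\<^sub>o S) = rearrange X (X \<otimes>\<^sub>o S) S \<cdot> (extend X S (\<one> (X \<otimes>\<^sub>o S)) \<otimes> \<one> S) \<cdot>
    inv_arrow C (Assoc C X S S) \<cdot> (\<one> X \<otimes> Copy C S)"
proof -
  have "Copy C (X \<otimes>\<^sub>o S) = rearrange X (X \<otimes>\<^sub>o S) S \<cdot> (Assoc C X X S \<otimes> \<one> S) \<cdot>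
      inv_arrow C (Assoc C (X \<otimes>\<^sub>o X) S S) \<cdot> (Copy C X \<otimes> (Swap C S S \<cdot> Copy C S))"
    using assms by (simp add: Copy_Tensor mid_swap_rearrange)
  also have "\<dots> = rearrange X (X \<otimes>\<^sub>o S) S \<cdot> (Assoc C X X S \<otimes> \<one> S) \<cdot>
      (inv_arrow C (Assoc C (X \<otimes>\<^sub>o X) S S) \<cdot> (Copy C X \<otimes> (\<one> S \<otimes> \<one> S))) \<cdot> (\<one> X \<otimes> Copy C S)"
    using assms by (simp add: Copy_comm Tensor_Ident)
  also have "inv_arrow C (Assoc C (X \<otimes>\<^sub>o X) S S) \<cdot> (Copy C X \<otimes> (\<one> S \<otimes> \<one> S))
      = ((Copy C X \<otimes> \<one> S) \<otimes> \<one> S) \<cdot> inv_arrow C (Assoc C X S S)"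
    using assms inv_Assoc_nat[of "Copy C X" "\<one> S" "\<one> S" X S S] by simp
  finally show ?thesis using assms by (simp add: extend_def Tensor_Ident)
qed

lemma Copy_tensor_comp:
  assumes "X \<in> Obj C" "S \<in> Obj C" "h \<in> Arr C" "Dom C h = X \<otimes>\<^sub>o S"
  shows "(\<one> (X \<otimes>\<^sub>o S) \<otimes> h) \<cdot> Copy C (X \<otimes>\<^sub>o S) = rearrange X (Cod C h) S \<cdot> (extend X S h \<otimes> \<one> S) \<cdot>
    inv_arrow C (Assoc C X S S) \<cdot> (\<one> X \<otimes> Copy C S)"
proof -
  have "(\<one> (X \<otimes>\<^sub>o S) \<otimes> h) \<cdot> Copy C (X \<otimes>\<^sub>o S)
      = ((\<one> (X \<otimes>\<^sub>o S) \<otimes> h) \<cdot> rearrange X (X \<otimes>\<^sub>o S) S) \<cdot> (extend X S (\<one> (X \<otimes>\<^sub>o S)) \<otimes> \<one> S) \<cdot>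
        inv_arrow C (Assoc C X S S) \<cdot> (\<one> X \<otimes> Copy C S)"
    using assms by (simp add: Copy_tensor_extend del: interchange_assoc)
  also have "(\<one> (X \<otimes>\<^sub>o S) \<otimes> h) \<cdot> rearrange X (X \<otimes>\<^sub>o S) S = rearrange X (Cod C h) S \<cdot> ((\<one> X \<otimes> h) \<otimes> \<one> S)"
    using assms rearrange_nat[of X S h "Cod C h"] by simp
  finally show ?thesis using assms by (simp add: comp_extend)
qed

text \<open>
  By the formula above, projecting one copy of \<open>(x, s)\<close> means extending \<open>x\<close> by \<open>x\<close>. The other
  projection then only discards what remains of \<open>s\<close>.
\<close>

lemma deterministic_proj1:
  assumes X: "X \<in> Obj C" and S: "S \<in> Obj C"
  shows "deterministic C (proj1 X S)"
proof -
  let ?r = "inv_arrow C (Assoc C X S S) \<cdot> (\<one> X \<otimes> Copy C S)"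
  have "(proj1 X S \<otimes> proj1 X S) \<cdot> Copy C (X \<otimes>\<^sub>o S)
      = (proj1 X S \<otimes> \<one> X) \<cdot> (\<one> (X \<otimes>\<^sub>o S) \<otimes> proj1 X S) \<cdot> Copy C (X \<otimes>\<^sub>o S)"
    using assms by simp
  also have "\<dots> = (proj1 X S \<otimes> \<one> X) \<cdot> rearrange X X S \<cdot> (extend X S (proj1 X S) \<otimes> \<one> S) \<cdot> ?r"
    using assms by (simp add: Copy_tensor_comp del: interchange_assoc)
  also have "\<dots> = ((proj1 X S \<otimes> \<one> X) \<cdot> rearrange X X S) \<cdot> (extend X S (proj1 X S) \<otimes> \<one> S) \<cdot> ?r"
    using assms by simp
  also have "\<dots> = (proj1 (X \<otimes>\<^sub>o X) S \<cdot> (extend X S (proj1 X S) \<otimes> \<one> S)) \<cdot> ?r"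
    using assms by (simp add: proj1_rearrange)
  also have "\<dots> = extend X S (\<one> X \<cdot> proj1 X S) \<cdot> proj1 (X \<otimes>\<^sub>o S) S \<cdot> ?r"
    using assms by (subst proj1_nat) simp_all
  also have "\<dots> = Copy C X \<cdot> (proj1 X S \<cdot> proj1 (X \<otimes>\<^sub>o S) S) \<cdot> ?r"
    using assms by (subst extend_proj1) (simp_all add: Tensor_Ident)
  also have "\<dots> = Copy C X \<cdot> proj1 X (S \<otimes>\<^sub>o S) \<cdot> (\<one> X \<otimes> Copy C S)"
    using assms by (simp flip: proj1_tensor)
  also have "\<dots> = Copy C X \<cdot> proj1 X S"
    using assms by (simp add: proj1_nat)
  finally show ?thesis using assms by (simp add: deterministic_def)
qed

text \<open>
  Copying the retained input of \<open>q\<close> gives the same as copying the input beforehand, by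
  coassociativity.
\<close>

lemma Copy_graph:
  assumes "q \<in> Arr C" "Cod C q = X" "Dom C q = S"
  shows "inv_arrow C (Assoc C X S S) \<cdot> (\<one> X \<otimes> Copy C S) \<cdot> graph q = (graph q \<otimes> \<one> S) \<cdot> Copy C S"
proof -
  have obj: "X \<in> Obj C" "S \<in> Obj C" using assms arr_Obj by blast+
  have "inv_arrow C (Assoc C X S S) \<cdot> (\<one> X \<otimes> Copy C S) \<cdot> graph q
      = (inv_arrow C (Assoc C X S S) \<cdot> (q \<otimes> (\<one> S \<otimes> \<one> S))) \<cdot> ((\<one> S \<otimes> Copy C S) \<cdot> Copy C S)"
    using assms obj by (simp add: graph_def Tensor_Ident)
  also have "inv_arrow C (Assoc C X S S) \<cdot> (q \<otimes> (\<one> S \<otimes> \<one> S)) = ((q \<otimes> \<one> S) \<otimes> \<one> S) \<cdot> inv_arrow C (Assoc C S S S)"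
    using assms obj inv_Assoc_nat[of q "\<one> S" "\<one> S" S S S] by simp
  also have "(\<one> S \<otimes> Copy C S) \<cdot> Copy C S = Assoc C S S S \<cdot> (Copy C S \<otimes> \<one> S) \<cdot> Copy C S"
    using obj by (simp only: Copy_assoc)
  finally show ?thesis using assms obj by (simp add: graph_def)
qed

text \<open>
  Two conditionals of the same arrow are almost surely equal. The hypothesis compares them
  as arrows that retain only \<open>x\<close>, whereas almost sure equality with respect to \<open>graph q\<close> has to
  retain \<open>(x, s)\<close>. But \<open>s\<close> is the input of the whole arrow, so it can be copied at the
  start.
\<close>

lemma as_equal_graph:
  assumes q: "q \<in> Arr C" "Cod C q = X" "Dom C q = S"
    and h: "h \<in> Arr C" "Dom C h = X \<otimes>\<^sub>o S" and h': "h' \<in> Arr C" "Dom C h' = X \<otimes>\<^sub>o S" "Cod C h' = Cod C h"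
    and eq: "extend X S h \<cdot> graph q = extend X S h' \<cdot> graph q"
  shows "as_equal C (graph q) h h'"
proof -
  have obj: "X \<in> Obj C" "S \<in> Obj C" using q arr_Obj by blast+
  have *: "(\<one> (X \<otimes>\<^sub>o S) \<otimes> k) \<cdot> Copy C (X \<otimes>\<^sub>o S) \<cdot> graph q
      = rearrange X (Cod C k) S \<cdot> ((extend X S k \<cdot> graph q) \<otimes> \<one> S) \<cdot> Copy C S"
    if k: "k \<in> Arr C" "Dom C k = X \<otimes>\<^sub>o S" for k
  proof -
    have "(\<one> (X \<otimes>\<^sub>o S) \<otimes> k) \<cdot> Copy C (X \<otimes>\<^sub>o S) \<cdot> graph q
        = ((\<one> (X \<otimes>\<^sub>o S) \<otimes> k) \<cdot> Copy C (X \<otimes>\<^sub>o S)) \<cdot> graph q"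
      using k q obj by simp
    also have "\<dots> = rearrange X (Cod C k) S \<cdot> (extend X S k \<otimes> \<one> S) \<cdot>
        (inv_arrow C (Assoc C X S S) \<cdot> (\<one> X \<otimes> Copy C S) \<cdot> graph q)"
      using k q obj by (simp add: Copy_tensor_comp)
    also have "\<dots> = rearrange X (Cod C k) S \<cdot> (extend X S k \<otimes> \<one> S) \<cdot> (graph q \<otimes> \<one> S) \<cdot> Copy C S"
      using q by (simp only: Copy_graph)
    finally show ?thesis using k q obj by simp
  qed
  show ?thesis
    unfolding as_equal_def using q h h' by (simp add: * eq)
qed

lemma as_equal_comp:
  assumes "as_equal C p f g" "p \<in> Arr C" "f \<in> Arr C" "g \<in> Arr C" "Dom C f = Cod C p" "Dom C g = Cod C p"
    "Cod C f = Y" "Cod C g = Y"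
  shows "f \<cdot> p = g \<cdot> p"
proof -
  let ?A = "Cod C p"
  have *: "proj2 ?A Y \<cdot> (\<one> ?A \<otimes> h) \<cdot> Copy C ?A \<cdot> p = h \<cdot> p"
    if h: "h \<in> Arr C" "Dom C h = ?A" "Cod C h = Y" for h
  proof -
    have "proj2 ?A Y \<cdot> (\<one> ?A \<otimes> h) \<cdot> Copy C ?A \<cdot> p = (proj2 ?A Y \<cdot> (\<one> ?A \<otimes> h)) \<cdot> Copy C ?A \<cdot> p"
      using h assms(2) by auto
    also have "\<dots> = h \<cdot> (proj2 ?A ?A \<cdot> Copy C ?A) \<cdot> p"
      using h assms(2) by (subst proj2_nat) auto
    finally show ?thesis using h assms(2) by (simp add: proj2_copy)
  qed
  show ?thesis
    using assms by (metis as_equal_def *)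
qed

lemma deterministic_comp:
  assumes "deterministic C f" "deterministic C g" "Dom C g = Cod C f"
  shows "deterministic C (g \<cdot> f)"
proof -
  have f: "f \<in> Arr C" "Copy C (Cod C f) \<cdot> f = (f \<otimes> f) \<cdot> Copy C (Dom C f)"
    and g: "g \<in> Arr C" "Copy C (Cod C g) \<cdot> g = (g \<otimes> g) \<cdot> Copy C (Dom C g)"
    using assms by (simp_all add: deterministic_def)
  have "Copy C (Cod C g) \<cdot> g \<cdot> f = (Copy C (Cod C g) \<cdot> g) \<cdot> f"
    using f(1) g(1) assms(3) by simp
  also have "\<dots> = (g \<otimes> g) \<cdot> Copy C (Cod C f) \<cdot> f"
    unfolding g(2) using f(1) g(1) assms(3) by simp
  finally show ?thesis
    using f g(1) assms(3) by (simp add: deterministic_def)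
qed

end

section \<open>Distribution objects\<close>

locale as_compatible_markov_category = markov_category C
  for C :: "('o, 'm, 'z) markov_category_scheme" (structure) +
  fixes P :: "'o \<Rightarrow> 'o" and samp :: "'o \<Rightarrow> 'm"
  assumes as_compatible: "as_compatibly_representable C P samp"
begin

lemma hom_det: "f \<in> hom (det_category C) X Y \<longleftrightarrow> f \<in> Arr C \<and> Dom C f = X \<and> Cod C f = Y \<and> deterministic C f"
  by (auto simp: hom_def det_category_def)

lemma samp_arr [simp]:
  assumes "X \<in> Obj C"
  shows "P X \<in> Obj C" "samp X \<in> Arr C" "Dom C (samp X) = P X" "Cod C (samp X) = X"
  using as_compatible assms
  by (auto simp: as_compatibly_representable_def representable_def distribution_object_def hom_iff)

lemma samp_bij:
  "\<lbrakk> X \<in> Obj C; A \<in> Obj C \<rbrakk> \<Longrightarrow> bij_betw (\<lambda>h. samp X \<cdot> h) (hom (det_category C) A (P X)) (hom C A X)"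
  using as_compatible
  by (auto simp: as_compatibly_representable_def representable_def distribution_object_def)

lemma samp_cancel:
  assumes "samp X \<cdot> g = samp X \<cdot> h" "X \<in> Obj C" "deterministic C g" "deterministic C h"
    "Dom C g = Dom C h" "Cod C g = P X" "Cod C h = P X"
  shows "g = h"
proof -
  have "g \<in> Arr C" "h \<in> Arr C" using assms by (simp_all add: deterministic_def)
  then show ?thesis
    using assms samp_bij[of X "Dom C g"]
    by (auto simp: bij_betw_def hom_det dest!: inj_onD)
qed

lemma sharp_arr [simp]:
  assumes f: "f \<in> Arr C"
  shows "sharp C P samp f \<in> Arr C" "Dom C (sharp C P samp f) = Dom C f"
    "Cod C (sharp C P samp f) = P (Cod C f)" "deterministic C (sharp C P samp f)"
    "samp (Cod C f) \<cdot> sharp C P samp f = f"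
proof -
  have b: "bij_betw (\<lambda>h. samp (Cod C f) \<cdot> h) (hom (det_category C) (Dom C f) (P (Cod C f)))
      (hom C (Dom C f) (Cod C f))"
    using f by (intro samp_bij) simp_all
  have "f \<in> hom C (Dom C f) (Cod C f)" using f by (simp add: hom_iff)
  then have "sharp C P samp f \<in> hom (det_category C) (Dom C f) (P (Cod C f))"
    "samp (Cod C f) \<cdot> sharp C P samp f = f"
    unfolding sharp_def using b
    by (auto simp: bij_betw_def intro: the_inv_into_into f_the_inv_into_f)
  then show "sharp C P samp f \<in> Arr C" "Dom C (sharp C P samp f) = Dom C f"
    "Cod C (sharp C P samp f) = P (Cod C f)" "deterministic C (sharp C P samp f)"
    "samp (Cod C f) \<cdot> sharp C P samp f = f"
    by (simp_all add: hom_det)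
qed

lemma sharp_samp:
  assumes "deterministic C g" "Cod C g = P X" "X \<in> Obj C"
  shows "sharp C P samp (samp X \<cdot> g) = g"
proof (rule samp_cancel[of X])
  have g: "g \<in> Arr C" using assms by (simp add: deterministic_def)
  then show "samp X \<cdot> sharp C P samp (samp X \<cdot> g) = samp X \<cdot> g"
    using assms sharp_arr(5)[of "samp X \<cdot> g"] by simp
  show "deterministic C (sharp C P samp (samp X \<cdot> g))" "Dom C (sharp C P samp (samp X \<cdot> g)) = Dom C g"
     "Cod C (sharp C P samp (samp X \<cdot> g)) = P X"
    using assms g by simp_all
qed (use assms in simp_all)

lemma P_map_arr [simp]:
  assumes "f \<in> Arr C"
  shows "P_map C P samp f \<in> Arr C" "Dom C (P_map C P samp f) = P (Dom C f)"
    "Cod C (P_map C P samp f) = P (Cod C f)" "deterministic C (P_map C P samp f)"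
  using assms by (simp_all add: P_map_def)

lemma samp_nat:
  assumes "f \<in> Arr C" "Cod C f = Y"
  shows "samp Y \<cdot> P_map C P samp f = f \<cdot> samp (Dom C f)"
    and "\<lbrakk> h \<in> Arr C; Cod C h = P (Dom C f) \<rbrakk> \<Longrightarrow> samp Y \<cdot> P_map C P samp f \<cdot> h = f \<cdot> samp (Dom C f) \<cdot> h"
proof -
  show *: "samp Y \<cdot> P_map C P samp f = f \<cdot> samp (Dom C f)"
    using assms sharp_arr(5)[of "f \<cdot> samp (Dom C f)"] by (auto simp add: P_map_def)
  assume h: "h \<in> Arr C" "Cod C h = P (Dom C f)"
  have "(samp Y \<cdot> P_map C P samp f) \<cdot> h = (f \<cdot> samp (Dom C f)) \<cdot> h"
    unfolding * ..
  then show "samp Y \<cdot> P_map C P samp f \<cdot> h = f \<cdot> samp (Dom C f) \<cdot> h"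
    using assms h by auto
qed

lemma P_map_sharp:
  assumes "f \<in> Arr C" "k \<in> Arr C" "Dom C f = Cod C k"
  shows "P_map C P samp f \<cdot> sharp C P samp k = sharp C P samp (f \<cdot> k)"
proof -
  let ?g = "P_map C P samp f \<cdot> sharp C P samp k"
  have "samp (Cod C f) \<cdot> ?g = f \<cdot> k"
    using assms by (simp add: samp_nat)
  moreover have "sharp C P samp (samp (Cod C f) \<cdot> ?g) = ?g"
    using assms by (intro sharp_samp deterministic_comp) simp_all
  ultimately show ?thesis by simp
qed

lemma sharp_as_equal:
  assumes "as_equal C p f g" "p \<in> Arr C" "f \<in> Arr C" "g \<in> Arr C"
    "Dom C f = Cod C p" "Dom C g = Cod C p" "Cod C f = Cod C g"
  shows "as_equal C p (sharp C P samp f) (sharp C P samp g)"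
proof -
  have "p \<in> hom C (Dom C p) (Cod C p)" "f \<in> hom C (Cod C p) (Cod C g)" "g \<in> hom C (Cod C p) (Cod C g)"
    using assms by (simp_all add: hom_iff)
  then show ?thesis
    using as_compatible assms unfolding as_compatibly_representable_def
    by (meson arr_Obj)
qed

text \<open>
  The heart of the proof: the naturality square of \<open>samp\<close> at a deterministic arrow is a weak pullback
  in \<open>C\<close>. The coupling of the two experiments is \<open>\<omega>\<close>, and the required arrow applies \<open>k\<^sup>#\<close> to the
  graph of \<open>q\<close>, for a conditional \<open>k\<close> of \<open>\<omega>\<close> given its component in \<open>P Y\<close>.
\<close>

lemma samp_weak_pullback:
  assumes cond: "has_conditionals C" and f: "deterministic C f"
    and q: "q \<in> Arr C" "Cod C q = P (Cod C f)" and p: "p \<in> Arr C" "Cod C p = Dom C f" "Dom C p = Dom C q"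
    and eq: "samp (Cod C f) \<cdot> q = f \<cdot> p"
  obtains r where "r \<in> Arr C" "Dom C r = Dom C q" "Cod C r = P (Dom C f)"
    "P_map C P samp f \<cdot> r = q" "samp (Dom C f) \<cdot> r = p"
proof -
  define S X Y where "S = Dom C q" "X = Dom C f" "Y = Cod C f"
  note SXY [symmetric, simp] = this
  have fA [simp]: "f \<in> Arr C" using f by (simp add: deterministic_def)
  have [simp]: "S \<in> Obj C" "X \<in> Obj C" "Y \<in> Obj C" using q(1) by (simp_all flip: SXY)
  note [simp] = q[unfolded SXY] p[unfolded SXY]
  \<comment> \<open>The joint law of a sample \<open>y\<close> and the measure \<open>\<pi>\<close> it is drawn from.\<close>
  define \<phi> where "\<phi> = (samp Y \<otimes> \<one> (P Y)) \<cdot> Copy C (P Y) \<cdot> q"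
  have \<phi> [simp]: "\<phi> \<in> Arr C" "Dom C \<phi> = S" "Cod C \<phi> = Y \<otimes>\<^sub>o P Y"
    by (simp_all add: \<phi>_def)
  have swap_\<phi>: "Swap C Y (P Y) \<cdot> \<phi> = (\<one> (P Y) \<otimes> samp Y) \<cdot> Copy C (P Y) \<cdot> q"
  proof -
    have "Swap C Y (P Y) \<cdot> \<phi> = (Swap C Y (P Y) \<cdot> (samp Y \<otimes> \<one> (P Y))) \<cdot> Copy C (P Y) \<cdot> q"
      by (simp add: \<phi>_def)
    also have "\<dots> = (\<one> (P Y) \<otimes> samp Y) \<cdot> (Swap C (P Y) (P Y) \<cdot> Copy C (P Y)) \<cdot> q"
      by (subst Swap_nat) simp_all
    finally show ?thesis by (simp add: Copy_comm)
  qed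
  have \<phi>1: "proj1 Y (P Y) \<cdot> \<phi> = f \<cdot> p"
  proof -
    have "proj1 Y (P Y) \<cdot> \<phi> = (proj1 Y (P Y) \<cdot> (samp Y \<otimes> \<one> (P Y))) \<cdot> Copy C (P Y) \<cdot> q"
      by (simp add: \<phi>_def)
    also have "\<dots> = samp Y \<cdot> (proj1 (P Y) (P Y) \<cdot> Copy C (P Y)) \<cdot> q"
      by (subst proj1_nat) simp_all
    finally show ?thesis using eq by (simp add: proj1_copy)
  qed
  have \<phi>2: "proj1 (P Y) Y \<cdot> Swap C Y (P Y) \<cdot> \<phi> = q"
  proof -
    have "proj1 (P Y) Y \<cdot> Swap C Y (P Y) \<cdot> \<phi> = (proj1 (P Y) Y \<cdot> (\<one> (P Y) \<otimes> samp Y)) \<cdot> Copy C (P Y) \<cdot> q"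
      unfolding swap_\<phi> by simp
    also have "\<dots> = (proj1 (P Y) (P Y) \<cdot> Copy C (P Y)) \<cdot> q"
      by (subst proj1_nat) simp_all
    finally show ?thesis by (simp add: proj1_copy)
  qed
  obtain c where "conditional C S Y (P Y) \<phi> c"
    using cond unfolding has_conditionals_def by (metis \<phi> hom_iff \<open>S \<in> Obj C\<close> \<open>Y \<in> Obj C\<close> samp_arr(1))
  then have c [simp]: "c \<in> Arr C" "Dom C c = Y \<otimes>\<^sub>o S" "Cod C c = P Y"
    and c_eq: "\<phi> = extend Y S c \<cdot> graph (f \<cdot> p)"
    using conditionalD[of S Y "P Y" \<phi> c] \<phi>1 by simp_all
  \<comment> \<open>Draw \<open>x\<close> from \<open>p\<close> and then \<open>\<pi>\<close> from its conditional law given \<open>y = f x\<close>.\<close>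
  define \<omega> where "\<omega> = extend X S (c \<cdot> (f \<otimes> \<one> S)) \<cdot> graph p"
  have \<omega> [simp]: "\<omega> \<in> Arr C" "Dom C \<omega> = S" "Cod C \<omega> = X \<otimes>\<^sub>o P Y"
    by (simp_all add: \<omega>_def)
  have \<omega>_p: "proj1 X (P Y) \<cdot> \<omega> = p"
  proof -
    have "proj1 X (P Y) \<cdot> \<omega> = (proj1 X (P Y) \<cdot> extend X S (c \<cdot> (f \<otimes> \<one> S))) \<cdot> graph p"
      by (simp add: \<omega>_def)
    also have "\<dots> = proj1 X S \<cdot> graph p"
      by (subst proj1_extend) simp_all
    finally show ?thesis by (simp add: proj1_graph)
  qed
  have \<omega>_\<phi>: "(f \<otimes> \<one> (P Y)) \<cdot> \<omega> = \<phi>"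
  proof -
    have "(f \<otimes> \<one> (P Y)) \<cdot> \<omega> = ((f \<otimes> \<one> (P Y)) \<cdot> extend X S (c \<cdot> (f \<otimes> \<one> S))) \<cdot> graph p"
      by (simp add: \<omega>_def)
    also have "(f \<otimes> \<one> (P Y)) \<cdot> extend X S (c \<cdot> (f \<otimes> \<one> S)) = extend Y S c \<cdot> (f \<otimes> \<one> S)"
      using deterministic_extend[OF f, of S c] by simp
    also have "\<dots> \<cdot> graph p = \<phi>"
      by (simp add: c_eq graph_comp)
    finally show ?thesis .
  qed
  \<comment> \<open>Conditionals are taken given the first output, so \<open>\<pi>\<close> is moved to the front.\<close>
  let ?\<sigma> = "Swap C X (P Y) \<cdot> \<omega>"
  have \<sigma>_\<phi>: "(\<one> (P Y) \<otimes> f) \<cdot> ?\<sigma> = Swap C Y (P Y) \<cdot> \<phi>"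
  proof -
    have "(\<one> (P Y) \<otimes> f) \<cdot> ?\<sigma> = (Swap C Y (P Y) \<cdot> (f \<otimes> \<one> (P Y))) \<cdot> \<omega>"
      by (subst Swap_nat) simp_all
    then show ?thesis by (simp flip: \<omega>_\<phi>)
  qed
  have \<sigma>_q: "proj1 (P Y) X \<cdot> ?\<sigma> = q"
  proof -
    have "proj1 (P Y) X \<cdot> ?\<sigma> = (proj1 (P Y) Y \<cdot> (\<one> (P Y) \<otimes> f)) \<cdot> ?\<sigma>"
      by (subst proj1_nat) simp_all
    also have "\<dots> = proj1 (P Y) Y \<cdot> (\<one> (P Y) \<otimes> f) \<cdot> ?\<sigma>" by simp
    finally show ?thesis unfolding \<sigma>_\<phi> \<phi>2 .
  qed
  have "?\<sigma> \<in> hom C S (P Y \<otimes>\<^sub>o X)" by (simp add: hom_iff)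
  then obtain k where "conditional C S (P Y) X ?\<sigma> k"
    using cond unfolding has_conditionals_def by (metis \<open>S \<in> Obj C\<close> \<open>X \<in> Obj C\<close> \<open>Y \<in> Obj C\<close> samp_arr(1))
  then have k [simp]: "k \<in> Arr C" "Dom C k = P Y \<otimes>\<^sub>o S" "Cod C k = X"
    and k_eq: "?\<sigma> = extend (P Y) S k \<cdot> graph q"
    using conditionalD[of S "P Y" X ?\<sigma> k] \<sigma>_q by simp_all
  have k_p: "k \<cdot> graph q = p"
  proof -
    have "k \<cdot> graph q = (proj2 (P Y) X \<cdot> extend (P Y) S k) \<cdot> graph q"
      by (simp add: proj2_extend)
    also have "\<dots> = proj2 (P Y) X \<cdot> ?\<sigma>" unfolding k_eq by simp
    also have "\<dots> = (proj2 (P Y) X \<cdot> Swap C X (P Y)) \<cdot> \<omega>" by simp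
    also have "\<dots> = p" by (simp add: proj2_Swap \<omega>_p)
    finally show ?thesis .
  qed
  \<comment> \<open>Both \<open>f \<cdot> k\<close> and \<open>samp Y \<cdot> proj1 (P Y) S\<close> are conditionals of \<open>y\<close> given \<open>\<pi>\<close>.\<close>
  have "extend (P Y) S (f \<cdot> k) \<cdot> graph q = (\<one> (P Y) \<otimes> f) \<cdot> ?\<sigma>"
    unfolding k_eq by (simp flip: comp_extend)
  also have "\<dots> = (\<one> (P Y) \<otimes> samp Y) \<cdot> Copy C (P Y) \<cdot> q"
    unfolding \<sigma>_\<phi> swap_\<phi> ..
  also have "\<dots> = extend (P Y) S (samp Y \<cdot> proj1 (P Y) S) \<cdot> graph q"
    by (simp add: extend_proj1 proj1_graph)
  finally have "as_equal C (graph q) (f \<cdot> k) (samp Y \<cdot> proj1 (P Y) S)"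
    by (rule as_equal_graph[rotated -1]) simp_all
  then have "as_equal C (graph q) (sharp C P samp (f \<cdot> k)) (sharp C P samp (samp Y \<cdot> proj1 (P Y) S))"
    by (rule sharp_as_equal) simp_all
  then have "as_equal C (graph q) (sharp C P samp (f \<cdot> k)) (proj1 (P Y) S)"
    by (simp add: sharp_samp deterministic_proj1)
  then have fk: "sharp C P samp (f \<cdot> k) \<cdot> graph q = q"
    using as_equal_comp[of "graph q" "sharp C P samp (f \<cdot> k)" "proj1 (P Y) S" "P Y"] by (simp add: proj1_graph)
  show thesis
  proof (rule that)
    show "P_map C P samp f \<cdot> (sharp C P samp k \<cdot> graph q) = q"
      using P_map_sharp[of f k] fk by (simp flip: assoc_arr)
    show "samp (Dom C f) \<cdot> (sharp C P samp k \<cdot> graph q) = p"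
      using sharp_arr(5)[of k] k_p by (simp flip: assoc_arr)
  qed simp_all
qed

lemma P_mult_arr [simp]:
  assumes "X \<in> Obj C"
  shows "P_mult C P samp X \<in> Arr C" "Dom C (P_mult C P samp X) = P (P X)"
    "Cod C (P_mult C P samp X) = P X" "deterministic C (P_mult C P samp X)"
  using assms by (simp_all add: P_mult_def)

lemma samp_P_mult:
  assumes "X \<in> Obj C" "h \<in> Arr C" "Cod C h = P (P X)"
  shows "samp X \<cdot> P_mult C P samp X \<cdot> h = samp X \<cdot> samp (P X) \<cdot> h"
  using assms by (simp add: P_mult_def samp_nat)

lemma P_mult_nat:
  assumes "f \<in> Arr C"
  shows "P_mult C P samp (Cod C f) \<cdot> P_map C P samp (P_map C P samp f)
    = P_map C P samp f \<cdot> P_mult C P samp (Dom C f)"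
proof (rule samp_cancel[of "Cod C f"])
  show "samp (Cod C f) \<cdot> P_mult C P samp (Cod C f) \<cdot> P_map C P samp (P_map C P samp f)
      = samp (Cod C f) \<cdot> P_map C P samp f \<cdot> P_mult C P samp (Dom C f)"
    using assms by (simp add: samp_P_mult samp_nat) (simp add: P_mult_def samp_nat)
qed (use assms in \<open>simp_all add: deterministic_comp\<close>)

text \<open>
  Composition with \<open>samp\<close> transposes the square of the multiplication into the square of \<open>samp\<close>,
  and the solution \<open>r\<close> found there is transposed back to \<open>r\<^sup>#\<close>.
\<close>

lemma P_mult_weak_pullback:
  assumes cond: "has_conditionals C" and f: "deterministic C f"
  shows "weak_pullback (det_category C) (P (P (Dom C f))) (P (P (Cod C f))) (P (Dom C f)) (P (Cod C f))
    (P_map C P samp (P_map C P samp f)) (P_mult C P samp (Dom C f)) (P_mult C P samp (Cod C f)) (P_map C P samp f)"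
proof -
  let ?X = "Dom C f" and ?Y = "Cod C f" and ?Pf = "P_map C P samp f"
  have fA [simp]: "f \<in> Arr C" using f by (simp add: deterministic_def)
  have Comp_det [simp]: "Comp (det_category C) = Comp C" by (simp add: det_category_def)
  have lift: "\<exists>r\<in>hom (det_category C) S (P (P ?X)).
      P_map C P samp ?Pf \<cdot> r = q \<and> P_mult C P samp ?X \<cdot> r = p"
    if q: "q \<in> hom (det_category C) S (P (P ?Y))" and p: "p \<in> hom (det_category C) S (P ?X)"
      and eq: "P_mult C P samp ?Y \<cdot> q = ?Pf \<cdot> p" for S q p
  proof -
    have q' [simp]: "q \<in> Arr C" "Dom C q = S" "Cod C q = P (P ?Y)" "deterministic C q"
      and p' [simp]: "p \<in> Arr C" "Dom C p = S" "Cod C p = P ?X" "deterministic C p"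
      using q p by (simp_all add: hom_det)
    have "samp ?Y \<cdot> samp (P ?Y) \<cdot> q = samp ?Y \<cdot> P_mult C P samp ?Y \<cdot> q"
      by (simp add: samp_P_mult)
    also have "\<dots> = f \<cdot> samp ?X \<cdot> p"
      unfolding eq by (simp add: samp_nat)
    finally have "samp ?Y \<cdot> samp (P ?Y) \<cdot> q = f \<cdot> samp ?X \<cdot> p" .
    then obtain r where r [simp]: "r \<in> Arr C" "Dom C r = S" "Cod C r = P ?X"
      and rq: "?Pf \<cdot> r = samp (P ?Y) \<cdot> q" and rp: "samp ?X \<cdot> r = samp ?X \<cdot> p"
      by (rule samp_weak_pullback[OF cond f, rotated -2]) simp_all
    let ?r = "sharp C P samp r"
    have sr: "samp (P ?X) \<cdot> ?r = r" using sharp_arr(5)[of r] by simp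
    have "P_map C P samp ?Pf \<cdot> ?r = q"
      using rq by (simp add: P_map_sharp sharp_samp)
    moreover have "P_mult C P samp ?X \<cdot> ?r = p"
    proof (rule samp_cancel[of ?X])
      show "samp ?X \<cdot> P_mult C P samp ?X \<cdot> ?r = samp ?X \<cdot> p"
        by (simp add: samp_P_mult sr rp)
    qed (simp_all add: deterministic_comp)
    ultimately show ?thesis by (intro bexI[of _ ?r]) (simp_all add: hom_det)
  qed
  show ?thesis
    unfolding weak_pullback_def Comp_det
    by (intro conjI ballI impI; (rule lift; assumption)?) (simp_all add: hom_det P_mult_nat)
qed

end

theorem theorem3p1:
  fixes C :: "('o, 'm, 'z) markov_category_scheme"
    and P :: "'o \<Rightarrow> 'o" and samp :: "'o \<Rightarrow> 'm"
  assumes "markov_category C"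
    and "as_compatibly_representable C P samp"
    and "has_conditionals C"
  shows "weakly_cartesian (det_category C)
    (\<lambda>X. P (P X)) (\<lambda>f. P_map C P samp (P_map C P samp f))
    P (P_map C P samp)
    (P_mult C P samp)"
proof -
  interpret as_compatible_markov_category C P samp
    using assms(1,2) by (simp add: as_compatible_markov_category_def as_compatible_markov_category_axioms_def)
  show ?thesis
    unfolding weakly_cartesian_def using P_mult_weak_pullback[OF assms(3)] by (auto simp: hom_det)
qed

end
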